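(* Let $d\ge 3$ and let $(B_t)_{0\le t\le 1}$ be $d$-dimensional Brownian motion started at $0$, with trace $B[0,1]=\{B_t:0\le t\le 1\}\subset\mathbf R^d$. Then $B[0,1]$ is almost surely capacity-equivalent to the unit square $[0,1]^2$. More precisely, with probability $1$ there exist random constants $C_1,C_2>0$ (depending on the Brownian path but not on $f$) such that $$C_1\,\mathrm{Cap}_f([0,1]^2)\;\le\;\mathrm{Cap}_f(B[0,1])\;\le\;C_2\,\mathrm{Cap}_f([0,1]^2)\qquad\text{for all kernels } f.$$
   Context: A kernel is a weakly decreasing function $f:[0,\infty)\to[0,\infty]$ such that $\lim_{r\downarrow0}f(r)=f(0)$ if this limit is finite. For a Borel measure $\nu$ on $\mathbf R^d$, its energy is $\mathcal E_f(\nu)=\int_{\mathbf R^d}\int_{\mathbf R^d}f(|x-y|)\,d\nu(x)\,d\nu(y)$, with $|\cdot|$ the Euclidean norm. For a Borel set $\Lambda\subset\mathbf R^d$, the capacity is $\mathrm{Cap}_f(\Lambda)=\left[\inf_{\nu}\mathcal E_f(\nu)\right]^{-1}$, the infimum being over Borel probability measures $\nu$ with $\nu(\Lambda)=1$ (with $1/\infty=0$, $1/0=\infty$). The square $[0,1]^2$ is regarded as a subset of $\mathbf R^d$ via the isometric embedding $\mathbf R^2\cong\mathbf R^2\times\{0\}^{d-2}$. Two sets $A,A'\subset\mathbf R^d$ are capacity-equivalent if there exist positive constants $C_1,C_2$ such that $C_1\mathrm{Cap}_f(A')\le\mathrm{Cap}_f(A)\le C_2\mathrm{Cap}_f(A')$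 for all kernels $f$. Constants are finite. *)

theory Defs
  imports "HOL-Probability.Probability"
begin

section \<open>Kernels, energy and capacity\<close>

text \<open>Only the restriction of a kernel to \<open>[0,\<infinity>)\<close> matters; values at negative arguments are
  unconstrained and never used. The one-sided limit at 0 always exists in \<open>[0,\<infinity>]\<close> by monotonicity.\<close>

definition kernel :: "(real \<Rightarrow> ennreal) \<Rightarrow> bool" where
  "kernel f \<longleftrightarrow>
     antimono_on {0..} f \<and>
     (\<forall>L. (f \<longlongrightarrow> L) (at_right 0) \<longrightarrow> L < \<infinity> \<longrightarrow> L = f 0)"

definition energy :: "(real \<Rightarrow> ennreal) \<Rightarrow> 'a::euclidean_space measure \<Rightarrow> ennreal" where
  "energy f \<nu> = (\<integral>\<^sup>+x. (\<integral>\<^sup>+y. f (norm (x - y)) \<partial>\<nu>) \<partial>\<nu>)"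

text \<open>In \<^typ>\<open>ennreal\<close>, \<open>inverse 0 = \<infinity>\<close> and \<open>inverse \<infinity> = 0\<close>. The notion is intended for Borel
  sets \<open>\<Lambda>\<close>; otherwise no measure qualifies, as \<^const>\<open>emeasure\<close> is 0 off the sigma-algebra.\<close>

definition capacity :: "(real \<Rightarrow> ennreal) \<Rightarrow> 'a::euclidean_space set \<Rightarrow> ennreal" where
  "capacity f \<Lambda> =
     inverse (INF \<nu>\<in>{\<nu>. prob_space \<nu> \<and> sets \<nu> = sets borel \<and> emeasure \<nu> \<Lambda> = 1}. energy f \<nu>)"

definition capacity_equivalent :: "'a::euclidean_space set \<Rightarrow> 'a set \<Rightarrow> bool" where
  "capacity_equivalent A A' \<longleftrightarrow>
     (\<exists>C1 C2 :: real. 0 < C1 \<and> 0 < C2 \<and>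
        (\<forall>f. kernel f \<longrightarrow>
           ennreal C1 * capacity f A' \<le> capacity f A \<and>
           capacity f A \<le> ennreal C2 * capacity f A'))"


section \<open>The unit square in \<open>\<real>\<^sup>d\<close>\<close>

text \<open>The index type of \<^typ>\<open>real ^ 'n\<close> carries no order, so the two coordinates spanning the
  plane are given as parameters \<open>i \<noteq> j\<close>.\<close>

definition plane_embedding :: "'n \<Rightarrow> 'n \<Rightarrow> real ^ 2 \<Rightarrow> real ^ 'n" where
  "plane_embedding i j v = (\<chi> k. if k = i then v $ 1 else if k = j then v $ 2 else 0)"

definition unit_square :: "'n \<Rightarrow> 'n \<Rightarrow> (real ^ 'n) set" where
  "unit_square i j = plane_embedding i j ` {v. \<forall>k. 0 \<le> v $ k \<and> v $ k \<le> 1}"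

lemma dist_plane_embedding:
  fixes i j :: "'n::finite"
  assumes "i \<noteq> j"
  shows "dist (plane_embedding i j v) (plane_embedding i j w) = dist v w"
proof -
  let ?g = "\<lambda>k. (dist (plane_embedding i j v $ k) (plane_embedding i j w $ k))\<^sup>2"
  have "(\<Sum>k\<in>UNIV. ?g k) = (\<Sum>k\<in>{i, j}. ?g k)"
    by (rule sum.mono_neutral_right) (auto simp: plane_embedding_def)
  also have "\<dots> = (\<Sum>k\<in>UNIV. (dist (v $ k) (w $ k))\<^sup>2)"
    using assms by (simp add: plane_embedding_def sum_2)
  finally show ?thesis
    by (simp add: dist_vec_def L2_set_def)
qed


section \<open>Brownian motion\<close>

text \<open>Standard Brownian motion in \<open>\<real>\<^sup>d\<close>, started at 0, on the time interval \<open>[0,1]\<close>. The increment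
  over \<open>[s,t]\<close> is centred Gaussian with covariance matrix \<open>t - s\<close> times the identity; the second
  argument of \<^const>\<open>normal_density\<close> is the standard deviation.\<close>

locale brownian_motion = prob_space M
  for M :: "'w measure" and B :: "real \<Rightarrow> 'w \<Rightarrow> real ^ 'n" +
  assumes measurable_B: "\<And>t. t \<in> {0..1} \<Longrightarrow> random_variable borel (B t)"
    and start: "AE \<omega> in M. B 0 \<omega> = 0"
    and continuous_paths: "AE \<omega> in M. continuous_on {0..1} (\<lambda>t. B t \<omega>)"
    and indep_increments:
      "\<And>(n::nat) t. (\<And>k. k \<le> n \<Longrightarrow> t k \<in> {0..1}) \<Longrightarrow> (\<And>k. k < n \<Longrightarrow> t k \<le> t (Suc k)) \<Longrightarrow>
         indep_vars (\<lambda>_. borel) (\<lambda>k \<omega>. B (t (Suc k)) \<omega> - B (t k) \<omega>) {..<n}"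
    and gaussian_increments:
      "\<And>s t. 0 \<le> s \<Longrightarrow> s < t \<Longrightarrow> t \<le> 1 \<Longrightarrow>
         distributed M lborel (\<lambda>\<omega>. B t \<omega> - B s \<omega>)
           (\<lambda>x. ennreal (\<Prod>k\<in>UNIV. normal_density 0 (sqrt (t - s)) (x $ k)))"

end

theory Submission
  imports Defs
begin

text \<open>
  Superlevel sets of a kernel are intervals starting at 0, so by the layer-cake formula the energy of
  \<open>\<nu>\<close> is governed by the pair masses \<open>(\<nu> \<times> \<nu>){|x - y| \<le> R}\<close>. Hence two sets are capacity-equivalent as
  soon as each of them carries a measure with pair masses of order at most \<open>R\<^sup>2\<close> and every probability
  measure on it has pair masses of order at least \<open>min 1 R\<^sup>2\<close>. The latter holds if the set can be covered
  by \<open>O(4\<^sup>n)\<close> balls of radius \<open>2\<^sup>-\<^sup>n\<close>.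

  For the Brownian path the covering is obtained by dyadic chaining: start from the times in
  \<open>4\<^sup>-\<^sup>n\<nat>\<close> and open a new ball after each dyadic refinement step that is too long. On a fixed
  level these steps are pairwise independent events, so Chebyshev bounds their number by \<open>O(4\<^sup>n)\<close>
  simultaneously for all \<open>n\<close>. The good measure is the occupation measure. Since \<open>d \<ge> 3\<close>,
  \<open>P(|B\<^sub>t - B\<^sub>s| \<le> r) \<le> (r/\<surd>|t - s|)\<^sup>3\<close>, which gives expected pair mass \<open>O(r\<^sup>2)\<close>; independence of increments over
  disjoint intervals controls the variance of the contribution of nearby times, and that of distant
  times is negligible already in expectation.
\<close>

section \<open>Pair masses and capacity\<close>

text \<open>The obstacle is that one random constant must serve all scales at once. A first-moment
  bound gives the right order at each single scale, but Markov's inequality then yields failure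
  probabilities that are not summable over n. For the covering, second moments repair this: the
  number of long steps has variance at most of order 4^n, which is negligible against 16^n. For the
  occupation measure the variance of the full pair mass is not directly accessible, because long
  time intervals overlap and are dependent. Hence a cutoff h = r^a for the time difference: the near
  part has relative variance of order h^2/r^2, which decays when a > 1, and the far part has
  relative mean of order r/sqrt h, which decays when a < 2. The value a = 3/2 is the middle of this
  window. The dimension enters through the integrability of t^(-3/2) at infinity; in the plane the
  corresponding t^(-1) would produce a logarithm.\<close>

definition pair_mass :: "'a::euclidean_space measure \<Rightarrow> real \<Rightarrow> ennreal" where
  "pair_mass \<nu> R = (\<integral>\<^sup>+x. (\<integral>\<^sup>+y. indicator {..R} (norm (x - y)) \<partial>\<nu>) \<partial>\<nu>)"

definition supported_prob :: "'a::euclidean_space set \<Rightarrow> 'a measure \<Rightarrow> bool" where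
  "supported_prob A \<nu> \<longleftrightarrow> prob_space \<nu> \<and> sets \<nu> = sets borel \<and> emeasure \<nu> A = 1"

text \<open>Two-dimensionality as seen by every kernel at once: one good measure bounds the capacity
  from below, and an estimate for all measures bounds it from above. The cap at 1 is forced, since
  the pair mass of a probability measure never exceeds 1.\<close>

definition planar_set :: "'a::euclidean_space set \<Rightarrow> bool" where
  "planar_set A \<longleftrightarrow>
     (\<exists>\<nu> C. supported_prob A \<nu> \<and> (\<forall>R>0. pair_mass \<nu> R \<le> ennreal (C * R\<^sup>2))) \<and>
     (\<exists>c>0. \<forall>\<nu>. supported_prob A \<nu> \<longrightarrow> (\<forall>R>0. ennreal (c * min 1 (R\<^sup>2)) \<le> pair_mass \<nu> R))"

section \<open>Layer-cake representation of the energy\<close>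

lemma ennreal_layer_cake:
  fixes a :: ennreal
  shows "(\<integral>\<^sup>+u. (if 0 \<le> u \<and> ennreal u < a then 1 else 0) \<partial>lborel) = a"
proof (cases a)
  case (real r)
  have "(\<integral>\<^sup>+u. (if 0 \<le> u \<and> ennreal u < a then 1 else 0) \<partial>lborel) = (\<integral>\<^sup>+u. indicator {0..<r} u \<partial>lborel)"
    using real by (intro nn_integral_cong) (auto simp: indicator_def ennreal_less_iff)
  also have "\<dots> = a"
    using real by simp
  finally show ?thesis .
next
  case top
  have "(\<integral>\<^sup>+u. (if 0 \<le> u \<and> ennreal u < a then 1 else 0) \<partial>lborel) = (\<integral>\<^sup>+u. indicator {0::real..} u \<partial>lborel)"
    using top by (intro nn_integral_cong) (auto simp: indicator_def)
  also have "\<dots> = emeasure lborel {0::real..}"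
    by simp
  also have "\<dots> = \<infinity>"
  proof -
    have "ennreal (real n) \<le> emeasure lborel {0::real..}" for n
    proof -
      have "ennreal (real n) = emeasure lborel {0..real n}" by simp
      also have "\<dots> \<le> emeasure lborel {0::real..}" by (rule emeasure_mono) auto
      finally show ?thesis .
    qed
    then show ?thesis
      by (metis ennreal_of_nat_eq_real_of_nat ennreal_Ex_less_of_nat infinity_ennreal_def linorder_not_less top.not_eq_extremum)
  qed
  finally show ?thesis using top by simp
qed

text \<open>A kernel is arbitrary at negative arguments, so \<open>f\<close> itself may fail to be
  Borel. The clamped function agrees with it on norms and decreases on the whole line, so its
  superlevel sets are intervals.\<close>

lemma kernel_clamp_measurable:
  assumes "kernel f"
  shows "(\<lambda>z. f (max 0 z)) \<in> borel_measurable borel"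
proof (rule borel_measurableI_greater)
  fix y
  have "is_interval {z. y < f (max 0 z)}"
  proof (clarsimp simp: is_interval_1)
    fix a b x assume "y < f (max 0 a)" "y < f (max 0 b)" "a \<le> x" "x \<le> (b::real)"
    moreover have "f (max 0 b) \<le> f (max 0 x)"
      using assms \<open>x \<le> b\<close> unfolding kernel_def monotone_on_def by auto
    ultimately show "y < f (max 0 x)" by order
  qed
  then show "{x \<in> space borel. y < f (max 0 x)} \<in> sets borel"
    by (simp add: real_interval_borel_measurable)
qed

lemma energy_layer_cake:
  fixes \<nu> :: "'a::euclidean_space measure"
  assumes f: "kernel f" and p: "prob_space \<nu>" and s[measurable_cong]: "sets \<nu> = sets borel"
  shows "energy f \<nu> = (\<integral>\<^sup>+u. (\<integral>\<^sup>+x. (\<integral>\<^sup>+y. (if 0 \<le> u \<and> ennreal u < f (norm (x - y)) then 1 else 0) \<partial>\<nu>) \<partial>\<nu>) \<partial>lborel)"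
proof -
  interpret prob_space \<nu> by fact
  interpret P: pair_sigma_finite lborel \<nu> ..
  define g where "g z = f (max 0 z)" for z
  have [measurable]: "g \<in> borel_measurable borel"
    using kernel_clamp_measurable[OF f] by (simp add: g_def[abs_def])
  have gf: "f (norm z) = g (norm z)" for z :: 'a
    by (simp add: g_def max_def)
  let ?I = "\<lambda>u x y. (if 0 \<le> u \<and> ennreal u < g (norm (x - y)) then 1 else 0) :: ennreal"
  have "energy f \<nu> = (\<integral>\<^sup>+x. (\<integral>\<^sup>+y. (\<integral>\<^sup>+u. ?I u x y \<partial>lborel) \<partial>\<nu>) \<partial>\<nu>)"
    unfolding energy_def gf ennreal_layer_cake ..
  also have "\<dots> = (\<integral>\<^sup>+x. (\<integral>\<^sup>+u. (\<integral>\<^sup>+y. ?I u x y \<partial>\<nu>) \<partial>lborel) \<partial>\<nu>)"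
    by (intro nn_integral_cong P.Fubini') measurable
  also have "\<dots> = (\<integral>\<^sup>+u. (\<integral>\<^sup>+x. (\<integral>\<^sup>+y. ?I u x y \<partial>\<nu>) \<partial>\<nu>) \<partial>lborel)"
    by (rule P.Fubini') measurable
  finally show ?thesis unfolding gf .
qed

lemma nn_integral_le_1:
  assumes "prob_space N" "\<And>x. f x \<le> (1::ennreal)"
  shows "(\<integral>\<^sup>+x. f x \<partial>N) \<le> 1"
proof -
  interpret prob_space N by fact
  have "(\<integral>\<^sup>+x. f x \<partial>N) \<le> (\<integral>\<^sup>+x. 1 \<partial>N)" using assms by (intro nn_integral_mono) auto
  then show ?thesis by (simp add: emeasure_space_1)
qed

lemma pair_mass_le_1:
  assumes "prob_space \<nu>" shows "pair_mass \<nu> R \<le> 1"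
  unfolding pair_mass_def
  by (intro nn_integral_le_1[OF assms]) (auto simp: indicator_def)

text \<open>The superlevel sets of a kernel inside \<open>[0,\<infinity>)\<close> are intervals starting at 0; the normalisation of
  \<open>f 0\<close> excludes the degenerate interval \<open>{0}\<close>, on which pair masses could not be compared.\<close>

lemma kernel_superlevel_cases:
  assumes f: "kernel f" and u: "u < \<infinity>"
  obtains "\<And>z. 0 \<le> z \<Longrightarrow> \<not> u < f z"
  | "\<And>z. 0 \<le> z \<Longrightarrow> u < f z"
  | R where "0 < R" "\<And>z. 0 \<le> z \<Longrightarrow> u < f z \<Longrightarrow> z \<le> R" "\<And>z. 0 \<le> z \<Longrightarrow> z < R \<Longrightarrow> u < f z"
proof -
  define S where "S = {z. 0 \<le> z \<and> u < f z}"
  have mono: "f b \<le> f a" if "0 \<le> a" "a \<le> b" for a b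
    using f that unfolding kernel_def monotone_on_def by auto
  consider "S = {}" | "S \<noteq> {}" "bdd_above S" | "\<not> bdd_above S"
    by (cases "S = {}"; cases "bdd_above S") simp_all
  then show thesis
  proof cases
    case 1 then show ?thesis using that(1) by (auto simp: S_def)
  next
    case 3
    have "u < f z" if "0 \<le> z" for z
    proof -
      obtain w where "w \<in> S" "z < w" using 3 by (meson bdd_above.I linorder_not_less)
      then show ?thesis using mono[of z w] that by (auto simp: S_def)
    qed
    then show ?thesis using that(2) by blast
  next
    case 2
    have low: "u < f z" if "0 \<le> z" and zS: "z < Sup S" for z
    proof -
      obtain w where "w \<in> S" "z < w" using 2 zS less_cSup_iff[of S z] by auto
      then show ?thesis using mono[of z w] that by (auto simp: S_def)
    qed
    have up: "z \<le> Sup S" if "0 \<le> z" "u < f z" for z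
      using 2 that by (intro cSup_upper) (auto simp: S_def)
    obtain z where z: "z \<in> S" using 2 by auto
    have "0 < Sup S"
    proof (rule ccontr)
      assume "\<not> 0 < Sup S"
      with up have le: "f z \<le> u" if "0 < z" for z using that by (meson less_eq_real_def linorder_not_less order_trans)
      \<comment> \<open>By monotonicity \<open>L\<close> is the right limit at 0. If the superlevel
        set were contained in {0}, then \<open>L\<close> \<le> \<open>u\<close> would be finite, and
        the normalisation of kernels would force \<open>f 0\<close> = \<open>L\<close> \<le>
        \<open>u\<close>.\<close>
      define L where "L = (SUP z\<in>{0<..}. f z)"
      have "(f \<longlongrightarrow> L) (at_right 0)"
      proof (rule increasing_tendsto)
        show "\<forall>\<^sub>F n in at_right 0. f n \<le> L"
          unfolding eventually_at_right_field L_def by (intro exI[of _ 1]) (auto intro!: SUP_upper)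
        fix x assume "x < L"
        then obtain z where "0 < z" "x < f z" unfolding L_def less_SUP_iff by auto
        then show "\<forall>\<^sub>F n in at_right 0. x < f n"
          unfolding eventually_at_right_field using mono by (intro exI[of _ z]) (auto intro: less_le_trans)
      qed
      moreover have "L \<le> u" unfolding L_def using le by (intro SUP_least) auto
      ultimately have "f 0 \<le> u" using f u unfolding kernel_def by (metis order.strict_trans1)
      moreover have "u < f z" "0 \<le> z" using z by (auto simp: S_def)
      ultimately show False using mono[of 0 z] by auto
    qed
    then show ?thesis using that(3)[of "Sup S"] low up by blast
  qed
qed

text \<open>The bound is checked at each level \<open>u\<close> and then integrated. It is unknown
  whether the superlevel interval contains its right endpoint R, so it is enlarged to [0,R] for
  \<open>\<nu>\<close> and shrunk to [0,R/2] for \<open>\<nu>'\<close>. The condition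
  \<open>1 \<le> K\<close> handles levels below all values of \<open>f\<close>, where both inner
  integrals are full masses.\<close>

lemma energy_comparison:
  fixes \<nu> \<nu>' :: "'a::euclidean_space measure"
  assumes f: "kernel f"
    and p: "prob_space \<nu>" "prob_space \<nu>'" and s[measurable_cong]: "sets \<nu> = sets borel" "sets \<nu>' = sets borel"
    and K: "1 \<le> K" and le: "\<And>R. 0 < R \<Longrightarrow> pair_mass \<nu> R \<le> ennreal K * pair_mass \<nu>' (R / 2)"
  shows "energy f \<nu> \<le> ennreal K * energy f \<nu>'"
proof -
  interpret N: prob_space \<nu> by fact
  interpret N': prob_space \<nu>' by fact
  define g where "g z = f (max 0 z)" for z
  have [measurable]: "g \<in> borel_measurable borel"
    using kernel_clamp_measurable[OF f] by (simp add: g_def[abs_def])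
  have gf: "f (norm z) = g (norm z)" for z :: 'a
    by (simp add: g_def max_def)
  let ?I = "\<lambda>u (x::'a) y. (if 0 \<le> u \<and> ennreal u < f (norm (x - y)) then 1 else 0) :: ennreal"
  have "(\<integral>\<^sup>+x. (\<integral>\<^sup>+y. ?I u x y \<partial>\<nu>) \<partial>\<nu>) \<le> ennreal K * (\<integral>\<^sup>+x. (\<integral>\<^sup>+y. ?I u x y \<partial>\<nu>') \<partial>\<nu>')" (is "?L \<le> _") for u
  proof (cases "u < 0")
    case False
    have "ennreal u < \<infinity>" by simp
    from f this show ?thesis
    proof (cases rule: kernel_superlevel_cases)
      case 1
      then show ?thesis by simp
    next
      case 2
      have "?L \<le> 1" by (intro nn_integral_le_1 p) auto
      also have "1 \<le> ennreal K" using K by simp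
      finally show ?thesis using 2 False by (simp add: N'.emeasure_space_1)
    next
      case (3 R)
      have "?L \<le> pair_mass \<nu> R"
        unfolding pair_mass_def using 3 by (intro nn_integral_mono) auto
      also note le[OF 3(1)]
      also have "pair_mass \<nu>' (R / 2) \<le> (\<integral>\<^sup>+x. (\<integral>\<^sup>+y. ?I u x y \<partial>\<nu>') \<partial>\<nu>')"
        unfolding pair_mass_def using 3 False by (intro nn_integral_mono) (auto simp: indicator_def)
      finally show ?thesis by (simp add: mult_left_mono)
    qed
  qed auto
  then have "energy f \<nu> \<le> (\<integral>\<^sup>+u. ennreal K * (\<integral>\<^sup>+x. (\<integral>\<^sup>+y. ?I u x y \<partial>\<nu>') \<partial>\<nu>') \<partial>lborel)"
    unfolding energy_layer_cake[OF f p(1) s(1)] by (intro nn_integral_mono) auto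
  also have "\<dots> = ennreal K * (\<integral>\<^sup>+u. (\<integral>\<^sup>+x. (\<integral>\<^sup>+y. ?I u x y \<partial>\<nu>') \<partial>\<nu>') \<partial>lborel)"
    unfolding gf by (rule nn_integral_cmult) measurable
  finally show ?thesis
    unfolding energy_layer_cake[OF f p(2) s(2)] .
qed

section \<open>Comparison of capacities\<close>

lemma ennreal_inverse_antimono:
  fixes a b :: ennreal
  assumes "a \<le> b"
  shows "inverse b \<le> inverse a"
  using assms including ennreal.lifting by transfer (rule ereal_inverse_antimono)

text \<open>A single good measure on \<open>A\<close> is compared with every competitor on
  \<open>A'\<close>, so its energy is at most K times the infimum over \<open>A'\<close>. The
  constant comes from pair masses alone and is fixed before \<open>f\<close>.\<close>

lemma capacity_le:
  fixes A A' :: "'a::euclidean_space set"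
  assumes A: "planar_set A" and A': "planar_set A'"
  shows "\<exists>K>0. \<forall>f. kernel f \<longrightarrow> capacity f A' \<le> ennreal K * capacity f A"
proof -
  obtain \<nu> C where nu: "supported_prob A \<nu>" and C: "\<And>R. 0 < R \<Longrightarrow> pair_mass \<nu> R \<le> ennreal (C * R\<^sup>2)"
    using A unfolding planar_set_def by blast
  obtain c where c: "c > 0" and lower: "\<And>\<nu> R. supported_prob A' \<nu> \<Longrightarrow> 0 < R \<Longrightarrow> ennreal (c * min 1 (R\<^sup>2)) \<le> pair_mass \<nu> R"
    using A' unfolding planar_set_def by blast
  \<comment> \<open>The 4 pays for passing from R to R/2. The inner \<open>max 1 C\<close> keeps the
    upper bound valid for R > 1, where the pair mass is only known to be at most 1. The outer
    maximum supplies the hypothesis \<open>1 \<le> K\<close> of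
    \<open>energy_comparison\<close>.\<close>
  define K where "K = max 1 (4 * max 1 C / c)"
  have K: "1 \<le> K" by (simp add: K_def)
  have en: "energy f \<nu> \<le> ennreal K * energy f \<nu>'" if f: "kernel f" and nu': "supported_prob A' \<nu>'" for f \<nu>'
  proof (rule energy_comparison)
    fix R :: real assume R: "0 < R"
    have "pair_mass \<nu> R \<le> ennreal (max 1 C * min 1 (R\<^sup>2))"
    proof (cases "R\<^sup>2 \<le> 1")
      case True
      have "pair_mass \<nu> R \<le> ennreal (C * R\<^sup>2)" by (rule C[OF R])
      also have "\<dots> \<le> ennreal (max 1 C * min 1 (R\<^sup>2))"
        using True by (intro ennreal_leI) (auto simp: min_def intro: mult_right_mono)
      finally show ?thesis .
    next
      case False
      have "pair_mass \<nu> R \<le> ennreal 1" using nu pair_mass_le_1 by (auto simp: supported_prob_def)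
      also have "\<dots> \<le> ennreal (max 1 C * min 1 (R\<^sup>2))"
        using False by (intro ennreal_leI) (auto simp: min_def)
      finally show ?thesis .
    qed
    also have "max 1 C * min 1 (R\<^sup>2) \<le> K * (c * min 1 ((R / 2)\<^sup>2))"
    proof -
      have "min 1 (R\<^sup>2) \<le> 4 * min 1 ((R / 2)\<^sup>2)"
        by (auto simp: min_def power_divide)
      then have "max 1 C * min 1 (R\<^sup>2) \<le> max 1 C * (4 * min 1 ((R / 2)\<^sup>2))"
        by (intro mult_left_mono) auto
      also have "\<dots> = (4 * max 1 C / c) * (c * min 1 ((R / 2)\<^sup>2))"
        using c by simp
      also have "\<dots> \<le> K * (c * min 1 ((R / 2)\<^sup>2))"
        using c by (intro mult_right_mono) (auto simp: K_def)
      finally show ?thesis .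
    qed
    also have "ennreal (K * (c * min 1 ((R / 2)\<^sup>2))) = ennreal K * ennreal (c * min 1 ((R / 2)\<^sup>2))"
      using K c by (intro ennreal_mult) auto
    also have "\<dots> \<le> ennreal K * pair_mass \<nu>' (R / 2)"
      using lower[OF nu', of "R / 2"] R by (intro mult_left_mono) auto
    finally show "pair_mass \<nu> R \<le> ennreal K * pair_mass \<nu>' (R / 2)" by (simp add: ennreal_leI)
  qed (use nu nu' f K in \<open>auto simp: supported_prob_def\<close>)
  have "capacity f A' \<le> ennreal K * capacity f A" if f: "kernel f" for f
  proof -
    define a where "a = (INF \<nu>\<in>{\<nu>. supported_prob A \<nu>}. energy f \<nu>)"
    define b where "b = (INF \<nu>\<in>{\<nu>. supported_prob A' \<nu>}. energy f \<nu>)"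
    have "a / ennreal K \<le> b"
      unfolding b_def
    proof (rule INF_greatest, rule divide_le_posI_ennreal)
      fix \<nu>' assume "\<nu>' \<in> {\<nu>. supported_prob A' \<nu>}"
      then have "energy f \<nu> \<le> ennreal K * energy f \<nu>'" using en[OF f] by simp
      moreover have "a \<le> energy f \<nu>" using nu unfolding a_def by (intro INF_lower) auto
      ultimately show "a \<le> ennreal K * energy f \<nu>'" by (rule order_trans[rotated])
    qed (use K in auto)
    then have "inverse b \<le> inverse (a / ennreal K)"
      by (rule ennreal_inverse_antimono)
    also have "\<dots> = inverse a * ennreal K"
    proof -
      have "inverse (ennreal K) = ennreal (1 / K)"
        using K by (simp add: inverse_ennreal inverse_eq_divide)
      then show ?thesis
        using K unfolding divide_ennreal_def
        by (subst ennreal_inverse_mult') (auto simp: inverse_ennreal)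
    qed
    finally have "inverse b \<le> ennreal K * inverse a" by (simp add: mult.commute)
    then show ?thesis
      by (simp add: capacity_def supported_prob_def a_def b_def)
  qed
  then show ?thesis using K by (intro exI[of _ K]) auto
qed

theorem planar_sets_capacity_equivalent:
  assumes "planar_set A" "planar_set A'"
  shows "capacity_equivalent A A'"
proof -
  obtain K where K: "K > 0" "\<And>f. kernel f \<Longrightarrow> capacity f A \<le> ennreal K * capacity f A'"
    using capacity_le[OF assms(2,1)] by blast
  obtain L where L: "L > 0" "\<And>f. kernel f \<Longrightarrow> capacity f A' \<le> ennreal L * capacity f A"
    using capacity_le[OF assms] by blast
  have "ennreal (1 / L) * capacity f A' \<le> capacity f A" if "kernel f" for f
  proof -
    have "ennreal (1 / L) * capacity f A' \<le> ennreal (1 / L) * (ennreal L * capacity f A)"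
      using L that by (intro mult_left_mono) auto
    also have "\<dots> = capacity f A"
      using L(1) by (simp flip: mult.assoc ennreal_mult)
    finally show ?thesis .
  qed
  then show ?thesis
    unfolding capacity_equivalent_def using K L(1) by (intro exI[of _ "1 / L"] exI[of _ K]) auto
qed

text \<open>Points whose \<open>R\<close>-neighbourhood has mass less than \<open>1/(2N)\<close> lie in covering sets of mass less
  than \<open>1/(2N)\<close>, hence have total mass at most \<open>1/2\<close>.\<close>

lemma pair_mass_covering_bound:
  fixes A :: "'a::euclidean_space set"
  assumes nu: "supported_prob A \<nu>" and T: "finite T" "card T \<le> N" and N: "0 < N"
    and cover: "A \<subseteq> (\<Union>x\<in>T. cball x (R / 2))" and R: "R > 0"
  shows "ennreal (1 / (4 * real N)) \<le> pair_mass \<nu> R"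
proof -
  interpret prob_space \<nu> using nu by (simp add: supported_prob_def)
  have s[measurable_cong]: "sets \<nu> = sets borel" using nu by (simp add: supported_prob_def)
  have sp: "space \<nu> = UNIV" using sets_eq_imp_space_eq[OF s] by simp
  have Am: "A \<in> sets \<nu>" using nu emeasure_notin_sets[of A \<nu>] by (auto simp: supported_prob_def)
  define T' where "T' = {x \<in> T. measure \<nu> (cball x (R / 2)) < 1 / (2 * real N)}"
  define D where "D = A - (\<Union>x\<in>T'. cball x (R / 2))"
  have T': "finite T'" "card T' \<le> N" using T unfolding T'_def by (auto intro: order_trans[OF card_mono])
  have cm: "cball x r \<in> sets \<nu>" for x r using s by simp
  have Dm: "D \<in> sets \<nu>" unfolding D_def using T' Am cm by (intro sets.Diff sets.finite_UN) auto
  have "measure \<nu> (\<Union>x\<in>T'. cball x (R / 2)) \<le> (\<Sum>x\<in>T'. measure \<nu> (cball x (R / 2)))"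
    using T' cm by (intro finite_measure_subadditive_finite) auto
  also have "\<dots> \<le> (\<Sum>x\<in>T'. 1 / (2 * real N))" by (intro sum_mono) (auto simp: T'_def)
  also have "\<dots> \<le> real N * (1 / (2 * real N))" using T' by (simp add: divide_right_mono)
  also have "\<dots> = 1 / 2" using N by simp
  finally have "measure \<nu> (\<Union>x\<in>T'. cball x (R / 2)) \<le> 1 / 2" .
  moreover have "measure \<nu> A = 1" using nu by (simp add: supported_prob_def measure_def)
  moreover have "measure \<nu> A \<le> measure \<nu> (D \<union> (\<Union>x\<in>T'. cball x (R / 2)))"
    using Dm cm T' by (intro finite_measure_mono sets.Un sets.finite_UN) (auto simp: D_def)
  moreover have "\<dots> \<le> measure \<nu> D + measure \<nu> (\<Union>x\<in>T'. cball x (R / 2))"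
    using Dm cm T' by (intro measure_Un_le sets.finite_UN) auto
  ultimately have half: "1 / 2 \<le> measure \<nu> D" by simp
  \<comment> \<open>Each point of \<open>D\<close> lies in a ball of mass at least 1/(2N) and
    diameter at most R, so the inner integral is at least 1/(2N) there; integrating over
    \<open>D\<close> costs the factor 1/2.\<close>
  have "ennreal (1 / (4 * real N)) \<le> ennreal (1 / (2 * real N)) * ennreal (measure \<nu> D)"
  proof -
    have "1 / (4 * real N) = 1 / (2 * real N) * (1 / 2)" by simp
    also have "\<dots> \<le> 1 / (2 * real N) * measure \<nu> D" using half by (intro mult_left_mono) auto
    finally show ?thesis by (simp add: ennreal_leI flip: ennreal_mult)
  qed
  also have "\<dots> = (\<integral>\<^sup>+x. ennreal (1 / (2 * real N)) * indicator D x \<partial>\<nu>)"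
    using Dm by (simp add: nn_integral_cmult_indicator emeasure_eq_measure)
  also have "\<dots> \<le> (\<integral>\<^sup>+x. (\<integral>\<^sup>+y. indicator {..R} (norm (x - y)) \<partial>\<nu>) \<partial>\<nu>)"
  proof (rule nn_integral_mono)
    fix x
    show "ennreal (1 / (2 * real N)) * indicator D x \<le> (\<integral>\<^sup>+y. indicator {..R} (norm (x - y)) \<partial>\<nu>)"
    proof (cases "x \<in> D")
      case True
      then obtain z where z: "z \<in> T" "z \<notin> T'" "x \<in> cball z (R / 2)"
        using cover unfolding D_def by blast
      then have "1 / (2 * real N) \<le> measure \<nu> (cball z (R / 2))" by (auto simp: T'_def)
      then have "ennreal (1 / (2 * real N)) \<le> emeasure \<nu> (cball z (R / 2))"
        by (simp add: emeasure_eq_measure ennreal_leI)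
      also have "\<dots> = (\<integral>\<^sup>+y. indicator (cball z (R / 2)) y \<partial>\<nu>)" using cm by simp
      also have "\<dots> \<le> (\<integral>\<^sup>+y. indicator {..R} (norm (x - y)) \<partial>\<nu>)"
      proof (intro nn_integral_mono)
        fix y
        have "norm (x - y) \<le> R" if "y \<in> cball z (R / 2)"
          using that z(3) dist_triangle_half_l[of z x "2*R" y] dist_triangle3[of x y z]
          by (auto simp: dist_norm norm_minus_commute)
        then show "indicator (cball z (R / 2)) y \<le> (indicator {..R} (norm (x - y)) :: ennreal)"
          by (auto simp: indicator_def)
      qed
      finally show ?thesis using True by simp
    qed simp
  qed
  finally show ?thesis unfolding pair_mass_def .
qed

section \<open>Reduction to geometric scales\<close>

lemma scale_between:
  fixes R b :: real assumes "0 < R" "R \<le> 1" "0 < b" "b < 1"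
  obtains n where "b ^ Suc n < R" "R \<le> b ^ n"
proof -
  have ex: "\<exists>n. b ^ n < R" using real_arch_pow_inv[of R b] assms by auto
  define m where "m = (LEAST n. b ^ n < R)"
  have m: "b ^ m < R" unfolding m_def using ex by (rule LeastI_ex)
  then obtain n where n: "m = Suc n" using assms by (cases m) auto
  have "\<not> b ^ n < R" using not_less_Least[of n "\<lambda>n. b ^ n < R"] n by (simp add: m_def)
  then show thesis using that m n by auto
qed

text \<open>Pair masses increase with R, so geometric scales suffice at the cost of constant
  factors: 16 is the square of the ratio 4 of consecutive radii. The ratio 1/4 for pair masses suits
  Brownian motion, where the time cutoff r^(3/2) at r = 4^(-n) is simply 8^(-n).\<close>

lemma planar_setI:
  fixes A :: "'a::euclidean_space set"
  assumes nu: "supported_prob A \<nu>" and C: "\<And>n::nat. pair_mass \<nu> ((1/4) ^ n) \<le> ennreal (C * (1/16) ^ n)"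
    and cover: "\<And>n::nat. \<exists>T. finite T \<and> real (card T) \<le> K * 4 ^ n \<and> A \<subseteq> (\<Union>x\<in>T. cball x ((1/2) ^ n))"
  shows "planar_set A"
proof -
  have p: "prob_space \<nu>" using nu by (simp add: supported_prob_def)
  have upper: "pair_mass \<nu> R \<le> ennreal (max 1 (16 * C) * R\<^sup>2)" if R: "0 < R" for R
  proof (cases "R \<le> 1")
    case True
    obtain n where n: "(1/4) ^ Suc n < R" "R \<le> (1/4) ^ n" using scale_between[OF R True, of "1/4"] by auto
    have "(1/16::real) ^ Suc n = ((1/4) ^ Suc n)\<^sup>2" by (simp add: power2_eq_square flip: power_mult_distrib)
    also have "\<dots> \<le> R\<^sup>2" using n by (intro power_mono) auto
    finally have *: "(1/16) ^ n \<le> 16 * R\<^sup>2" by simp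
    have "pair_mass \<nu> R \<le> pair_mass \<nu> ((1/4) ^ n)"
      unfolding pair_mass_def using n by (intro nn_integral_mono) (auto simp: indicator_def)
    also have "\<dots> \<le> ennreal (C * (1/16) ^ n)" by (rule C)
    also have "\<dots> \<le> ennreal (max 1 (16 * C) * R\<^sup>2)"
    proof (rule ennreal_leI)
      have "C * (1/16) ^ n \<le> max 0 C * (1/16) ^ n" by (intro mult_right_mono) auto
      also have "\<dots> \<le> max 0 C * (16 * R\<^sup>2)" using * by (intro mult_left_mono) auto
      also have "\<dots> = (16 * max 0 C) * R\<^sup>2" by simp
      also have "\<dots> \<le> max 1 (16 * C) * R\<^sup>2" by (intro mult_right_mono) auto
      finally show "C * (1/16) ^ n \<le> max 1 (16 * C) * R\<^sup>2" .
    qed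
    finally show ?thesis .
  next
    case False
    have "pair_mass \<nu> R \<le> ennreal 1" using pair_mass_le_1[OF p] by simp
    also have "\<dots> \<le> ennreal (max 1 (16 * C) * R\<^sup>2)"
    proof (rule ennreal_leI)
      have "1 * 1 \<le> max 1 (16 * C) * R\<^sup>2" using False by (intro mult_mono) auto
      then show "1 \<le> max 1 (16 * C) * R\<^sup>2" by simp
    qed
    finally show ?thesis .
  qed
  \<comment> \<open>The covering bound takes a positive natural number of balls, while
    \<open>K\<close> is an arbitrary real; adding 1 keeps \<open>L\<close> positive even for
    nonpositive \<open>K\<close>.\<close>
  define L where "L = nat \<lceil>K\<rceil> + 1"
  have L: "K \<le> real L" "1 \<le> L" unfolding L_def by linarith+
  have lower: "ennreal (1 / (64 * real L) * min 1 (R\<^sup>2)) \<le> pair_mass \<nu>' R"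
    if nu': "supported_prob A \<nu>'" and R: "0 < R" for \<nu>' R
  proof -
    define r where "r = min R 1"
    have r: "0 < r" "r \<le> 1" using R by (auto simp: r_def)
    obtain n where n: "(1/2) ^ Suc n < r" "r \<le> (1/2) ^ n" using scale_between[OF r, of "1/2"] by auto
    \<comment> \<open>Two levels finer than \<open>n\<close>: from 2^(-n-1) < r it follows that
      2^(-n-2) < r/2, the radius required by \<open>pair_mass_covering_bound\<close>. The price is
      4^2, which together with the 4 of that lemma gives 64.\<close>
    obtain T where T: "finite T" "real (card T) \<le> K * 4 ^ Suc (Suc n)" "A \<subseteq> (\<Union>x\<in>T. cball x ((1/2) ^ Suc (Suc n)))"
      using cover[of "Suc (Suc n)"] by blast
    have sub: "cball x ((1/2) ^ Suc (Suc n)) \<subseteq> cball x (r / 2)" for x :: 'a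
      using n by (intro subset_cball) auto
    have "real (card T) \<le> real L * 4 ^ Suc (Suc n)"
      using T(2) L(1) by (rule order_trans[OF _ mult_right_mono]) auto
    then have cT: "card T \<le> L * 4 ^ Suc (Suc n)"
      by (simp flip: of_nat_le_iff[where 'a = real])
    have "ennreal (1 / (64 * real L) * min 1 (R\<^sup>2)) \<le> ennreal (1 / (4 * real (L * 4 ^ Suc (Suc n))))"
    proof (rule ennreal_leI)
      have "min 1 (R\<^sup>2) = r\<^sup>2"
        using R power_le_one[of R 2] one_le_power[of R 2] by (auto simp: r_def min_def)
      also have "\<dots> \<le> ((1/2) ^ n)\<^sup>2" using n r by (intro power_mono) auto
      also have "\<dots> = (1/4) ^ n" by (simp add: power2_eq_square flip: power_mult_distrib)
      finally have "1 / (64 * real L) * min 1 (R\<^sup>2) \<le> 1 / (64 * real L) * (1/4) ^ n"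
        by (intro mult_left_mono) auto
      also have "\<dots> = 1 / (4 * real (L * 4 ^ Suc (Suc n)))"
        by (simp add: power_divide)
      finally show "1 / (64 * real L) * min 1 (R\<^sup>2) \<le> 1 / (4 * real (L * 4 ^ Suc (Suc n)))" .
    qed
    also have "\<dots> \<le> pair_mass \<nu>' r"
      using L by (intro pair_mass_covering_bound[OF nu' T(1) cT _ _ r(1)] order_trans[OF T(3)] UN_mono sub) auto
    also have "\<dots> \<le> pair_mass \<nu>' R"
      unfolding pair_mass_def by (intro nn_integral_mono) (auto simp: indicator_def r_def)
    finally show ?thesis .
  qed
  have "0 < 1 / (64 * real L)" using L by simp
  then show ?thesis
    unfolding planar_set_def using nu upper lower by blast
qed


section \<open>The unit square\<close>

text \<open>A density on the whole line, rather than a restricted space, keeps the space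
  \<open>UNIV\<close> and the Borel sigma-algebra. It serves both for the coordinates of the square
  and for the time parameter.\<close>

definition unit_lebesgue :: "real measure" where
  "unit_lebesgue = density lborel (indicator {0..1})"

lemma sets_unit_lebesgue[measurable_cong, simp]: "sets unit_lebesgue = sets borel"
  by (simp add: unit_lebesgue_def)

lemma space_unit_lebesgue[simp]: "space unit_lebesgue = UNIV"
  by (simp add: unit_lebesgue_def)

lemma prob_space_unit_lebesgue: "prob_space unit_lebesgue"
  by (rule prob_spaceI) (simp add: unit_lebesgue_def emeasure_density)

lemma nn_integral_unit_lebesgue:
  assumes [measurable]: "f \<in> borel_measurable borel"
  shows "(\<integral>\<^sup>+t. f t \<partial>unit_lebesgue) = (\<integral>\<^sup>+t. indicator {0..1} t * f t \<partial>lborel)"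
  by (simp add: unit_lebesgue_def nn_integral_density)

lemma nn_integral_unit_lebesgue_le:
  assumes [measurable]: "f \<in> borel_measurable borel"
  shows "(\<integral>\<^sup>+t. f t \<partial>unit_lebesgue) \<le> (\<integral>\<^sup>+t. f t \<partial>lborel)"
  unfolding nn_integral_unit_lebesgue[OF assms] by (intro nn_integral_mono) (auto simp: indicator_def)

lemma AE_unit_lebesgue: "AE t in unit_lebesgue. t \<in> {0..1}"
  unfolding unit_lebesgue_def by (subst AE_density) (auto simp: indicator_def)

text \<open>The good measure is the image of product Lebesgue measure. A ball of radius R projects
  to intervals of length 2R in the coordinates \<open>i\<close> and \<open>j\<close>, hence has mass
  at most 4R^2. A regular grid gives the covering.\<close>

lemma planar_unit_square:
  fixes i j :: "'n::finite"
  assumes ij: "i \<noteq> j"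
  shows "planar_set (unit_square i j)"
proof (rule planar_setI)
  interpret U: prob_space unit_lebesgue by (rule prob_space_unit_lebesgue)
  interpret UU: pair_prob_space unit_lebesgue unit_lebesgue ..
  define E :: "real \<times> real \<Rightarrow> real ^ 'n" where "E p = plane_embedding i j (vector [fst p, snd p])" for p
  have E_alt: "E p = (\<chi> k. if k = i then fst p else if k = j then snd p else 0)" for p
    by (simp add: E_def plane_embedding_def vec_eq_iff)
  have cE: "continuous_on UNIV E"
    unfolding E_alt
  proof (rule continuous_on_vec_lambda)
    show "continuous_on UNIV (\<lambda>p. if k = i then fst p else if k = j then snd p else 0 :: real)" for k
      by (cases "k = i"; cases "k = j") (auto intro: continuous_intros)
  qed
  have Em[measurable]: "E \<in> borel_measurable borel"
    using cE by (rule borel_measurable_continuous_onI)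
  have sq: "unit_square i j = E ` ({0..1} \<times> {0..1})"
  proof -
    have "v \<in> (\<lambda>p. vector [fst p, snd p]) ` ({0..1} \<times> {0..1})" if "\<forall>k. 0 \<le> v $ k \<and> v $ k \<le> 1" for v :: "real ^ 2"
      using that by (intro image_eqI[of _ _ "(v $ 1, v $ 2)"]) (auto simp: vec_eq_iff forall_2)
    then have "{v :: real ^ 2. \<forall>k. 0 \<le> v $ k \<and> v $ k \<le> 1} = (\<lambda>p. vector [fst p, snd p]) ` ({0..1} \<times> {0..1})"
      by (auto simp: forall_2)
    then show ?thesis unfolding unit_square_def by (simp add: image_image E_def)
  qed
  define \<nu> where "\<nu> = distr (unit_lebesgue \<Otimes>\<^sub>M unit_lebesgue) borel E"
  have EmU[measurable]: "E \<in> measurable (unit_lebesgue \<Otimes>\<^sub>M unit_lebesgue) borel"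
    using Em unfolding borel_prod[symmetric]
    by (simp cong: measurable_cong_sets sets_pair_measure_cong)
  have pnu: "prob_space \<nu>" unfolding \<nu>_def by (rule UU.prob_space_distr) measurable
  have snu[measurable_cong]: "sets \<nu> = sets borel" by (simp add: \<nu>_def)
  have "compact (unit_square i j)"
    unfolding sq by (intro compact_continuous_image continuous_on_subset[OF cE] compact_Times) auto
  then have sb: "unit_square i j \<in> sets borel" by (intro borel_closed compact_imp_closed)
  have "AE p in unit_lebesgue \<Otimes>\<^sub>M unit_lebesgue. E p \<in> unit_square i j"
  proof (rule UU.AE_pair_measure)
    show "{p \<in> space (unit_lebesgue \<Otimes>\<^sub>M unit_lebesgue). E p \<in> unit_square i j} \<in> sets (unit_lebesgue \<Otimes>\<^sub>M unit_lebesgue)"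
      using measurable_sets[OF EmU sb] by (simp add: vimage_def Int_def conj_commute)
    show "AE x in unit_lebesgue. AE y in unit_lebesgue. E (x, y) \<in> unit_square i j"
      using AE_unit_lebesgue
    proof eventually_elim
      case (elim x)
      show ?case using AE_unit_lebesgue by eventually_elim (use elim in \<open>auto simp: sq\<close>)
    qed
  qed
  then have "emeasure \<nu> (unit_square i j) = 1"
    unfolding \<nu>_def using sb
    by (subst emeasure_distr) (auto intro!: UU.emeasure_eq_1_AE measurable_sets[OF EmU])
  then show "supported_prob (unit_square i j) \<nu>"
    using pnu snu by (simp add: supported_prob_def)
  show "pair_mass \<nu> ((1/4) ^ n) \<le> ennreal (4 * (1/16) ^ n)" for n
  proof -
    define R :: real where "R = (1/4) ^ n"
    have R: "R > 0" by (simp add: R_def)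
    interpret nu: prob_space \<nu> by fact
    have "(\<integral>\<^sup>+y. indicator {..R} (norm (x - y)) \<partial>\<nu>) \<le> ennreal (4 * R\<^sup>2)" for x
    proof -
      have "(\<integral>\<^sup>+y. indicator {..R} (norm (x - y)) \<partial>\<nu>) =
          (\<integral>\<^sup>+a. (\<integral>\<^sup>+b. indicator {..R} (norm (x - E (a, b))) \<partial>unit_lebesgue) \<partial>unit_lebesgue)"
        unfolding \<nu>_def by (simp add: nn_integral_distr U.nn_integral_fst[symmetric])
      also have "\<dots> \<le> (\<integral>\<^sup>+a. (\<integral>\<^sup>+b. indicator {x $ i - R..x $ i + R} a * indicator {x $ j - R..x $ j + R} b \<partial>unit_lebesgue) \<partial>unit_lebesgue)"
      proof (intro nn_integral_mono)
        fix a b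
        have "\<bar>x $ i - a\<bar> \<le> norm (x - E (a, b))" "\<bar>x $ j - b\<bar> \<le> norm (x - E (a, b))"
          using component_le_norm_cart[of "x - E (a, b)" i] component_le_norm_cart[of "x - E (a, b)" j] ij
          by (auto simp: E_alt)
        then show "indicator {..R} (norm (x - E (a, b))) \<le> (indicator {x $ i - R..x $ i + R} a * indicator {x $ j - R..x $ j + R} b :: ennreal)"
          by (auto simp: indicator_def)
      qed
      also have "\<dots> \<le> (\<integral>\<^sup>+a. indicator {x $ i - R..x $ i + R} a * (\<integral>\<^sup>+b. indicator {x $ j - R..x $ j + R} b \<partial>lborel) \<partial>unit_lebesgue)"
        by (subst nn_integral_cmult) (auto intro!: nn_integral_mono mult_left_mono nn_integral_unit_lebesgue_le simp del: nn_integral_indicator)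
      also have "\<dots> = (\<integral>\<^sup>+a. indicator {x $ i - R..x $ i + R} a * ennreal (2 * R) \<partial>unit_lebesgue)"
        using R by simp
      also have "\<dots> \<le> (\<integral>\<^sup>+a. indicator {x $ i - R..x $ i + R} a * ennreal (2 * R) \<partial>lborel)"
        by (rule nn_integral_unit_lebesgue_le) measurable
      also have "\<dots> = ennreal (2 * R) * ennreal (2 * R)"
        using R by (simp add: nn_integral_multc)
      also have "\<dots> = ennreal (4 * R\<^sup>2)"
        using R by (simp add: power2_eq_square flip: ennreal_mult)
      finally show ?thesis .
    qed
    then have "pair_mass \<nu> R \<le> (\<integral>\<^sup>+x. ennreal (4 * R\<^sup>2) \<partial>\<nu>)"
      unfolding pair_mass_def by (intro nn_integral_mono)
    also have "\<dots> = ennreal (4 * R\<^sup>2)" by (simp add: nu.emeasure_space_1)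
    also have "R\<^sup>2 = (1/16) ^ n" by (simp add: R_def power2_eq_square flip: power_mult_distrib)
    finally show ?thesis by (simp add: R_def)
  qed
  show "\<exists>T. finite T \<and> real (card T) \<le> 16 * 4 ^ n \<and> unit_square i j \<subseteq> (\<Union>x\<in>T. cball x ((1/2) ^ n))" for n
  proof -
    \<comment> \<open>With mesh 2^(-n-1) each coordinate is off by at most 2^(-n-1), so the sum of
      the two errors is at most 2^(-n). The number of grid points is (N+1)^2 \<le> (2N)^2 = 16 *
      4^n.\<close>
    define N :: nat where "N = 2 ^ Suc n"
    define T where "T = (\<lambda>(a, b). E (real a / real N, real b / real N)) ` ({..N} \<times> {..N})"
    have N: "N \<ge> 1" by (simp add: N_def)
    have "card T \<le> card ({..N} \<times> {..N})" unfolding T_def by (rule card_image_le) auto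
    also have "\<dots> = (N + 1)\<^sup>2" by (simp add: power2_eq_square)
    also have "\<dots> \<le> (2 * N)\<^sup>2" using N by (intro power_mono) auto
    also have "\<dots> = 16 * 4 ^ n" by (simp add: N_def power2_eq_square flip: power_mult_distrib)
    finally have card: "real (card T) \<le> 16 * 4 ^ n" by (simp flip: of_nat_le_iff[where 'a = real])
    have near: "\<exists>k\<le>N. \<bar>real k / real N - a\<bar> \<le> (1/2) ^ Suc n" if "a \<in> {0..1}" for a :: real
    proof (intro exI conjI)
      let ?k = "nat \<lfloor>real N * a\<rfloor>"
      have "real N * a \<le> real N" using that by (simp add: mult_left_le)
      then show "?k \<le> N" by linarith
      have "0 \<le> real N * a" using that by simp
      then have "\<bar>real ?k - real N * a\<bar> \<le> 1" by linarith
      then have "\<bar>real ?k - real N * a\<bar> / real N \<le> 1 / real N" by (intro divide_right_mono) auto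
      also have "\<bar>real ?k - real N * a\<bar> / real N = \<bar>(real ?k - real N * a) / real N\<bar>" by simp
      also have "(real ?k - real N * a) / real N = real ?k / real N - a" using N by (simp add: field_simps)
      also have "1 / real N = (1/2) ^ Suc n" by (simp add: N_def power_divide)
      finally show "\<bar>real ?k / real N - a\<bar> \<le> (1/2) ^ Suc n" .
    qed
    have "unit_square i j \<subseteq> (\<Union>x\<in>T. cball x ((1/2) ^ n))"
    proof
      fix z assume "z \<in> unit_square i j"
      then obtain a b where ab: "a \<in> {0..1}" "b \<in> {0..1}" "z = E (a, b)" unfolding sq by auto
      obtain k l where kl: "k \<le> N" "l \<le> N" "\<bar>real k / real N - a\<bar> \<le> (1/2) ^ Suc n" "\<bar>real l / real N - b\<bar> \<le> (1/2) ^ Suc n"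
        using near[OF ab(1)] near[OF ab(2)] by blast
      have "dist (E (real k / real N, real l / real N)) z =
          norm (vector [real k / real N, real l / real N] - vector [a, b] :: real ^ 2)"
        unfolding ab E_def dist_plane_embedding[OF ij] by (simp add: dist_norm)
      also have "\<dots> \<le> \<bar>real k / real N - a\<bar> + \<bar>real l / real N - b\<bar>"
        using norm_le_l1_cart[of "vector [real k / real N, real l / real N] - vector [a, b] :: real ^ 2"]
        by (simp add: sum_2)
      also have "\<dots> \<le> (1/2) ^ Suc n + (1/2) ^ Suc n" using kl by (intro add_mono) auto
      finally have "z \<in> cball (E (real k / real N, real l / real N)) ((1/2) ^ n)" by simp
      moreover have "E (real k / real N, real l / real N) \<in> T"
        unfolding T_def using kl by (intro image_eqI[of _ _ "(k, l)"]) auto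
      ultimately show "z \<in> (\<Union>x\<in>T. cball x ((1/2) ^ n))" by blast
    qed
    then show ?thesis using card by (intro exI[of _ T]) (auto simp: T_def)
  qed
qed


section \<open>Gaussian increments\<close>

text \<open>Expanding the square, pairwise independence annihilates the off-diagonal covariances,
  and each diagonal term p - p^2 is at most p. The nonnegative integral is the form in which the
  bound is later summed over infinitely many scales.\<close>

lemma (in prob_space) variance_pairwise_indep_events:
  assumes I: "finite I" and A: "\<And>i. i \<in> I \<Longrightarrow> A i \<in> events"
    and ind: "\<And>i j. i \<in> I \<Longrightarrow> j \<in> I \<Longrightarrow> i \<noteq> j \<Longrightarrow> prob (A i \<inter> A j) = prob (A i) * prob (A j)"
  shows "(\<integral>\<^sup>+\<omega>. ennreal (((\<Sum>i\<in>I. indicator (A i) \<omega>) - (\<Sum>i\<in>I. prob (A i)))\<^sup>2) \<partial>M) \<le> ennreal (\<Sum>i\<in>I. prob (A i))"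
proof -
  let ?Y = "\<lambda>i \<omega>. indicator (A i) \<omega> - prob (A i) :: real"
  have Y[measurable]: "i \<in> I \<Longrightarrow> ?Y i \<in> borel_measurable M" for i using A by auto
  have sq: "((\<Sum>i\<in>I. indicator (A i) \<omega>) - (\<Sum>i\<in>I. prob (A i)))\<^sup>2 = (\<Sum>i\<in>I. \<Sum>j\<in>I. ?Y i \<omega> * ?Y j \<omega>)" for \<omega>
    unfolding sum_subtractf[symmetric] power2_eq_square sum_product ..
  have expand: "?Y i \<omega> * ?Y j \<omega> = indicator (A i \<inter> A j) \<omega> - prob (A i) * indicator (A j) \<omega> - prob (A j) * indicator (A i) \<omega> + prob (A i) * prob (A j)" for i j \<omega>
    by (auto simp: indicator_def algebra_simps)
  have ii: "integrable M (indicator (A i \<inter> A j) :: _ \<Rightarrow> real)" "integrable M (indicator (A i) :: _ \<Rightarrow> real)" if "i \<in> I" "j \<in> I" for i j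
    using A that by (auto intro!: integrable_real_indicator simp: less_top[symmetric])
  have int: "integrable M (\<lambda>\<omega>. ?Y i \<omega> * ?Y j \<omega>)" if "i \<in> I" "j \<in> I" for i j
    unfolding expand
    by (intro Bochner_Integration.integrable_add Bochner_Integration.integrable_diff integrable_mult_right)
      (auto intro: ii that)
  have cov: "expectation (\<lambda>\<omega>. ?Y i \<omega> * ?Y j \<omega>) = prob (A i \<inter> A j) - prob (A i) * prob (A j)" if "i \<in> I" "j \<in> I" for i j
    unfolding expand using ii[OF that] ii(2)[OF that(2,1)] A that by (simp add: prob_space)
  have "(\<integral>\<^sup>+\<omega>. ennreal (((\<Sum>i\<in>I. indicator (A i) \<omega>) - (\<Sum>i\<in>I. prob (A i)))\<^sup>2) \<partial>M)
      = ennreal (expectation (\<lambda>\<omega>. ((\<Sum>i\<in>I. indicator (A i) \<omega>) - (\<Sum>i\<in>I. prob (A i)))\<^sup>2))"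
  proof (rule nn_integral_eq_integral)
    show "integrable M (\<lambda>\<omega>. ((\<Sum>i\<in>I. indicator (A i) \<omega>) - (\<Sum>i\<in>I. prob (A i)))\<^sup>2)"
      unfolding sq by (intro Bochner_Integration.integrable_sum int)
  qed simp
  also have "expectation (\<lambda>\<omega>. ((\<Sum>i\<in>I. indicator (A i) \<omega>) - (\<Sum>i\<in>I. prob (A i)))\<^sup>2) = (\<Sum>i\<in>I. expectation (\<lambda>\<omega>. \<Sum>j\<in>I. ?Y i \<omega> * ?Y j \<omega>))"
    unfolding sq by (intro Bochner_Integration.integral_sum Bochner_Integration.integrable_sum int)
  also have "\<dots> = (\<Sum>i\<in>I. \<Sum>j\<in>I. expectation (\<lambda>\<omega>. ?Y i \<omega> * ?Y j \<omega>))"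
    by (intro sum.cong refl Bochner_Integration.integral_sum int)
  also have "\<dots> = (\<Sum>i\<in>I. \<Sum>j\<in>I. prob (A i \<inter> A j) - prob (A i) * prob (A j))"
    by (intro sum.cong refl cov)
  also have "\<dots> = (\<Sum>i\<in>I. \<Sum>j\<in>I. if j = i then prob (A i) - prob (A i) * prob (A i) else 0)"
    using ind by (intro sum.cong) auto
  also have "\<dots> = (\<Sum>i\<in>I. prob (A i) - prob (A i) * prob (A i))"
    using I by simp
  also have "\<dots> \<le> (\<Sum>i\<in>I. prob (A i))"
    by (intro sum_mono) auto
  finally show ?thesis by (simp add: ennreal_leI)
qed

section \<open>Almost sure bounds from summable expectations\<close>

lemma ennreal_le_suminf: "f n \<le> (\<Sum>n. f n :: ennreal)"
  using sum_le_suminf[of f "{n}"] by (simp add: summableI)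

text \<open>Plays the part of Borel-Cantelli: a series with finite expectation is almost surely
  finite, and its sum dominates every term. This yields one random constant for all indices, not
  only for large ones.\<close>

lemma AE_bounded_if_summable_nn_integral:
  fixes g :: "nat \<Rightarrow> 'a \<Rightarrow> ennreal"
  assumes [measurable]: "\<And>n. g n \<in> borel_measurable M" and fin: "(\<Sum>n. \<integral>\<^sup>+\<omega>. g n \<omega> \<partial>M) < \<infinity>"
  shows "AE \<omega> in M. \<exists>K::real. 0 \<le> K \<and> (\<forall>n. g n \<omega> \<le> ennreal K)"
proof -
  have "(\<integral>\<^sup>+\<omega>. (\<Sum>n. g n \<omega>) \<partial>M) \<noteq> \<infinity>"
    using fin by (subst nn_integral_suminf) auto
  then have "AE \<omega> in M. (\<Sum>n. g n \<omega>) \<noteq> \<infinity>"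
    by (intro nn_integral_PInf_AE) auto
  then show ?thesis
  proof eventually_elim
    case (elim \<omega>)
    then obtain K where K: "0 \<le> K" "(\<Sum>n. g n \<omega>) = ennreal K" by (cases "\<Sum>n. g n \<omega>") auto
    have "g n \<omega> \<le> ennreal K" for n
      unfolding K(2)[symmetric] by (rule ennreal_le_suminf)
    then show ?case using K(1) by blast
  qed
qed

lemma suminf_ennreal_less_top:
  assumes "\<And>n. g n \<le> ennreal (h n)" "\<And>n. 0 \<le> h n" "summable h"
  shows "(\<Sum>n. g n) < (\<infinity>::ennreal)"
proof -
  have "(\<Sum>n. g n) \<le> (\<Sum>n. ennreal (h n))" using assms by (intro suminf_le) auto
  also have "\<dots> < \<infinity>" using assms(2,3) by (subst suminf_ennreal2) auto
  finally show ?thesis .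
qed

section \<open>Small-ball, independence and moment estimates\<close>

context brownian_motion
begin

text \<open>Reduces Gaussian estimates to one-dimensional integrals: the density is a product over
  coordinates, and so is Lebesgue measure.\<close>

lemma nn_integral_increment_prod:
  assumes st: "0 \<le> s" "s < t" "t \<le> 1" and g[measurable]: "\<And>k. g k \<in> borel_measurable borel"
  shows "(\<integral>\<^sup>+\<omega>. (\<Prod>k\<in>UNIV. g k ((B t \<omega> - B s \<omega>) $ k)) \<partial>M) =
    (\<Prod>k\<in>UNIV. \<integral>\<^sup>+x. ennreal (normal_density 0 (sqrt (t - s)) x) * g k x \<partial>lborel)"
proof -
  let ?n = "normal_density 0 (sqrt (t - s))"
  let ?e = "\<lambda>k::'n. axis k (1::real)"
  have inj: "inj ?e" by (auto simp: inj_on_def axis_eq_axis)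
  have B: "Basis = range ?e" by (auto simp: Basis_vec_def)
  \<comment> \<open>The product formula for \<open>lborel\<close> runs over basis vectors, so the
    coordinate factors are reindexed along \<open>k\<close> \<mapsto>
    \<open>axis k 1\<close>.\<close>
  define f where "f b x = ennreal (?n x) * g (inv ?e b) x" for b x
  have [measurable]: "f b \<in> borel_measurable borel" for b unfolding f_def[abs_def] by measurable
  have fe: "f (?e k) = (\<lambda>x. ennreal (?n x) * g k x)" for k by (simp add: f_def[abs_def] inv_f_f[OF inj])
  have "(\<integral>\<^sup>+\<omega>. (\<Prod>k\<in>UNIV. g k ((B t \<omega> - B s \<omega>) $ k)) \<partial>M) =
      (\<integral>\<^sup>+x. ennreal (\<Prod>k\<in>UNIV. ?n (x $ k)) * (\<Prod>k\<in>UNIV. g k (x $ k)) \<partial>lborel)"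
    by (rule distributed_nn_integral[OF gaussian_increments[OF st], symmetric]) measurable
  also have "\<dots> = (\<integral>\<^sup>+x. (\<Prod>b\<in>Basis. f b (x \<bullet> b)) \<partial>lborel)"
    by (intro nn_integral_cong)
      (simp add: B prod.reindex[OF inj] fe prod.distrib inner_axis flip: prod_ennreal)
  also have "\<dots> = (\<Prod>b\<in>Basis. \<integral>\<^sup>+x. f b x \<partial>lborel)"
    by (rule nn_integral_lborel_prod) auto
  also have "\<dots> = (\<Prod>k\<in>UNIV. \<integral>\<^sup>+x. ennreal (?n x) * g k x \<partial>lborel)"
    by (simp add: B prod.reindex[OF inj] fe)
  finally show ?thesis .
qed

lemma measurable_increment:
  assumes "s \<in> {0..1}" "t \<in> {0..1}"
  shows "(\<lambda>\<omega>. B t \<omega> - B s \<omega>) \<in> borel_measurable M"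
  using measurable_B assms by (intro borel_measurable_diff) auto

text \<open>The ball lies in the cube of side 2r. In each coordinate the density is at most 1/(2
  sigma), because 2 pi \<ge> 4, so the coordinate probability is at most r/sigma, and trivially at
  most 1. The cut at 1 is what allows the exponent d to be lowered to 3.\<close>

lemma prob_increment_small:
  assumes st: "0 \<le> s" "s < t" "t \<le> 1" and r: "0 \<le> r" and d: "CARD('n) \<ge> 3"
  shows "prob {\<omega>\<in>space M. norm (B t \<omega> - B s \<omega>) \<le> r} \<le> (r / sqrt (t - s)) ^ 3"
proof -
  let ?n = "normal_density 0 (sqrt (t - s))"
  have [measurable]: "B t \<in> borel_measurable M" "B s \<in> borel_measurable M" using st by (auto intro: measurable_B)
  let ?q = "min 1 (r / sqrt (t - s))"
  have q: "(\<integral>\<^sup>+x. ennreal (?n x) * indicator {-r..r} x \<partial>lborel) \<le> ennreal ?q"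
  proof -
    have "(\<integral>\<^sup>+x. ennreal (?n x) * indicator {-r..r} x \<partial>lborel) \<le> (\<integral>\<^sup>+x. ennreal (?n x) \<partial>lborel)"
      by (intro nn_integral_mono) (auto simp: indicator_def)
    also have "\<dots> = 1" using st by (subst nn_integral_eq_integral) auto
    finally have 1: "(\<integral>\<^sup>+x. ennreal (?n x) * indicator {-r..r} x \<partial>lborel) \<le> ennreal 1" by simp
    have "(\<integral>\<^sup>+x. ennreal (?n x) * indicator {-r..r} x \<partial>lborel) \<le> (\<integral>\<^sup>+x. ennreal (1 / (2 * sqrt (t - s))) * indicator {-r..r} x \<partial>lborel)"
    proof (intro nn_integral_mono mult_right_mono ennreal_leI)
      fix x
      have "4 * (t - s) \<le> 2 * pi * (t - s)" using st pi_gt3 by (intro mult_right_mono) auto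
      then have "2 * sqrt (t - s) \<le> sqrt (2 * pi * (sqrt (t - s))\<^sup>2)"
        using st by (simp add: real_le_rsqrt power_mult_distrib)
      then have "1 / sqrt (2 * pi * (sqrt (t - s))\<^sup>2) \<le> 1 / (2 * sqrt (t - s))"
        using st by (intro divide_left_mono) auto
      then have "1 / sqrt (2 * pi * (sqrt (t - s))\<^sup>2) * exp (-(x - 0)\<^sup>2 / (2 * (sqrt (t - s))\<^sup>2)) \<le> 1 / (2 * sqrt (t - s)) * 1"
        using st by (intro mult_mono) auto
      then show "?n x \<le> 1 / (2 * sqrt (t - s))" by (simp add: normal_density_def)
    qed auto
    also have "\<dots> = ennreal (r / sqrt (t - s))"
      using r st by (simp add: nn_integral_cmult flip: ennreal_mult)
    finally show ?thesis using 1 by (simp add: min_def)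
  qed
  have "emeasure M {\<omega>\<in>space M. norm (B t \<omega> - B s \<omega>) \<le> r} = (\<integral>\<^sup>+\<omega>. indicator {\<omega>\<in>space M. norm (B t \<omega> - B s \<omega>) \<le> r} \<omega> \<partial>M)"
    by (subst nn_integral_indicator) auto
  also have "\<dots> \<le> (\<integral>\<^sup>+\<omega>. (\<Prod>k\<in>UNIV. indicator {-r..r} ((B t \<omega> - B s \<omega>) $ k)) \<partial>M)"
  proof (rule nn_integral_mono)
    fix \<omega>
    show "indicator {\<omega> \<in> space M. norm (B t \<omega> - B s \<omega>) \<le> r} \<omega> \<le> (\<Prod>k\<in>UNIV. indicator {-r..r} ((B t \<omega> - B s \<omega>) $ k) :: ennreal)"
    proof (cases "norm (B t \<omega> - B s \<omega>) \<le> r")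
      case True
      then have "(B t \<omega> - B s \<omega>) $ k \<in> {-r..r}" for k
        using component_le_norm_cart[of "B t \<omega> - B s \<omega>" k] by (auto simp: abs_le_iff)
      then have "(\<Prod>k\<in>UNIV. indicator {-r..r} ((B t \<omega> - B s \<omega>) $ k) :: ennreal) = 1"
        by (intro prod.neutral) (auto simp: indicator_def)
      then show ?thesis by (simp add: indicator_def)
    qed simp
  qed
  also have "\<dots> = (\<Prod>k\<in>(UNIV::'n set). \<integral>\<^sup>+x. ennreal (?n x) * indicator {-r..r} x \<partial>lborel)"
    by (rule nn_integral_increment_prod[OF st]) auto
  also have "\<dots> \<le> (\<Prod>k\<in>(UNIV::'n set). ennreal ?q)"
    unfolding prod_constant by (rule power_mono_ennreal) (rule q)
  also have "\<dots> = ennreal (?q ^ CARD('n))"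
    using r st by (simp add: ennreal_power)
  also have "\<dots> \<le> ennreal ((r / sqrt (t - s)) ^ 3)"
  proof (rule ennreal_leI)
    have "?q ^ CARD('n) \<le> ?q ^ 3" using r st d by (intro power_decreasing) auto
    also have "\<dots> \<le> (r / sqrt (t - s)) ^ 3" using r st by (intro power_mono) auto
    finally show "?q ^ CARD('n) \<le> (r / sqrt (t - s)) ^ 3" .
  qed
  finally show ?thesis using r st by (simp add: emeasure_eq_measure)
qed

lemma prob_increments_indep:
  assumes t: "0 \<le> s" "s \<le> t" "t \<le> s'" "s' \<le> t'" "t' \<le> 1" and U: "U \<in> sets borel" "V \<in> sets borel"
  shows "prob {\<omega>\<in>space M. B t \<omega> - B s \<omega> \<in> U \<and> B t' \<omega> - B s' \<omega> \<in> V} =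
    prob {\<omega>\<in>space M. B t \<omega> - B s \<omega> \<in> U} * prob {\<omega>\<in>space M. B t' \<omega> - B s' \<omega> \<in> V}"
proof -
  \<comment> \<open>Four times give three increments; the middle one, over the gap from
    \<open>t\<close> to \<open>s'\<close>, is discarded by selecting the indices 0 and 2.\<close>
  define \<tau> where "\<tau> k = (if k = 0 then s else if k = 1 then t else if k = 2 then s' else t')" for k :: nat
  let ?X = "\<lambda>k \<omega>. B (\<tau> (Suc k)) \<omega> - B (\<tau> k) \<omega>"
  let ?A = "\<lambda>k::nat. if k = 0 then U else V"
  have "indep_vars (\<lambda>_. borel) ?X {..<3}"
    by (rule indep_increments) (use t in \<open>auto simp: \<tau>_def\<close>)
  then have "prob (\<Inter>k\<in>{0,2}. ?X k -` ?A k \<inter> space M) = (\<Prod>k\<in>{0,2}. prob (?X k -` ?A k \<inter> space M))"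
    by (rule indep_varsD) (use U in auto)
  moreover have "(\<Inter>k\<in>{0,2}. ?X k -` ?A k \<inter> space M) = {\<omega>\<in>space M. B t \<omega> - B s \<omega> \<in> U \<and> B t' \<omega> - B s' \<omega> \<in> V}"
    by (auto simp: \<tau>_def)
  moreover have "?X 0 -` U \<inter> space M = {\<omega>\<in>space M. B t \<omega> - B s \<omega> \<in> U}" "?X 2 -` V \<inter> space M = {\<omega>\<in>space M. B t' \<omega> - B s' \<omega> \<in> V}"
    by (auto simp: \<tau>_def)
  ultimately show ?thesis by simp
qed

text \<open>Markov's inequality for the 20th moment of the coordinates: if the norm exceeds a, some
  coordinate exceeds a/D in absolute value. In the chaining, depth l has 2^l times more intervals
  and will carry the weight 4^l, so long steps need probability decaying faster than 8^(-l); this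
  moment yields 10^(-l).\<close>

lemma prob_increment_large:
  "\<exists>C\<ge>0. \<forall>s t a. 0 \<le> s \<longrightarrow> s < t \<longrightarrow> t \<le> 1 \<longrightarrow> 0 < a \<longrightarrow>
     prob {\<omega>\<in>space M. a < norm (B t \<omega> - B s \<omega>)} \<le> C * (sqrt (t - s) / a) ^ 20"
proof -
  define D where "D = real CARD('n)"
  have D: "D > 0" by (simp add: D_def)
  \<comment> \<open>The 20th moment of the standard normal distribution.\<close>
  define c where "c = (fact 20 / (2 ^ 10 * fact 10) :: real)"
  have c: "c \<ge> 0" by (simp add: c_def)
  have "prob {\<omega>\<in>space M. a < norm (B t \<omega> - B s \<omega>)} \<le> D * (D ^ 20 * c) * (sqrt (t - s) / a) ^ 20"
    if st: "0 \<le> s" "s < t" "t \<le> 1" and a: "0 < a" for s t a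
  proof -
  let ?n = "normal_density 0 (sqrt (t - s))"
  have [measurable]: "B t \<in> borel_measurable M" "B s \<in> borel_measurable M" using st by (auto intro: measurable_B)
  have comp[measurable]: "(\<lambda>\<omega>. (B t \<omega> - B s \<omega>) $ k) \<in> borel_measurable M" for k
  proof (rule measurable_compose[of "\<lambda>\<omega>. B t \<omega> - B s \<omega>" M borel])
    show "(\<lambda>x :: real ^ 'n. x $ k) \<in> borel_measurable borel"
      by (intro borel_measurable_continuous_onI continuous_intros)
  qed measurable
  have moment: "(\<integral>\<^sup>+\<omega>. ennreal ((D * (B t \<omega> - B s \<omega>) $ k / a) ^ 20) \<partial>M) = ennreal (D ^ 20 * c * (sqrt (t - s) / a) ^ 20)" for k
  proof -
    let ?g = "\<lambda>l x. if l = k then ennreal ((D * x / a) ^ 20) else 1"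
    have "(\<integral>\<^sup>+\<omega>. ennreal ((D * (B t \<omega> - B s \<omega>) $ k / a) ^ 20) \<partial>M) = (\<integral>\<^sup>+\<omega>. (\<Prod>l\<in>UNIV. ?g l ((B t \<omega> - B s \<omega>) $ l)) \<partial>M)"
      by (intro nn_integral_cong) (simp add: prod.delta)
    also have "\<dots> = (\<Prod>l\<in>UNIV. \<integral>\<^sup>+x. ennreal (?n x) * ?g l x \<partial>lborel)"
      by (rule nn_integral_increment_prod[OF st]) auto
    also have "\<dots> = (\<Prod>l\<in>UNIV. if l = k then \<integral>\<^sup>+x. ennreal (?n x) * ennreal ((D * x / a) ^ 20) \<partial>lborel else 1)"
      using st by (intro prod.cong) (auto simp: nn_integral_eq_integral)
    also have "\<dots> = (\<integral>\<^sup>+x. ennreal (?n x) * ennreal ((D * x / a) ^ 20) \<partial>lborel)"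
      by (simp add: prod.delta)
    also have "\<dots> = (\<integral>\<^sup>+x. ennreal ((D / a) ^ 20 * (?n x * x ^ 20)) \<partial>lborel)"
      by (intro nn_integral_cong) (simp add: power_divide power_mult_distrib mult_ac flip: ennreal_mult)
    also have "\<dots> = ennreal ((D / a) ^ 20 * (fact 20 / ((2 / (sqrt (t - s))\<^sup>2) ^ 10 * fact 10)))"
    proof -
      have "has_bochner_integral lborel (\<lambda>x. (D / a) ^ 20 * (?n x * x ^ 20)) ((D / a) ^ 20 * (fact 20 / ((2 / (sqrt (t - s))\<^sup>2) ^ 10 * fact 10)))"
        using normal_moment_even[of "sqrt (t - s)" 0 10] st by (intro has_bochner_integral_mult_right) simp
      then show ?thesis
        by (subst nn_integral_eq_integral) (auto simp: has_bochner_integral_iff)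
    qed
    also have "(D / a) ^ 20 * (fact 20 / ((2 / (sqrt (t - s))\<^sup>2) ^ 10 * fact 10)) = D ^ 20 * c * (sqrt (t - s) / a) ^ 20"
    proof -
      have "(2 / (sqrt (t - s))\<^sup>2) ^ 10 = 2 ^ 10 / (sqrt (t - s)) ^ 20"
        by (simp only: power_divide power_mult[symmetric]) simp
      then show ?thesis unfolding c_def by (simp add: power_divide mult_ac)
    qed
    finally show ?thesis .
  qed
  have "emeasure M {\<omega>\<in>space M. a < norm (B t \<omega> - B s \<omega>)} = (\<integral>\<^sup>+\<omega>. indicator {\<omega>\<in>space M. a < norm (B t \<omega> - B s \<omega>)} \<omega> \<partial>M)"
    by (subst nn_integral_indicator) auto
  also have "\<dots> \<le> (\<integral>\<^sup>+\<omega>. (\<Sum>k\<in>UNIV. ennreal ((D * (B t \<omega> - B s \<omega>) $ k / a) ^ 20)) \<partial>M)"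
  proof (rule nn_integral_mono)
    fix \<omega>
    show "indicator {\<omega>\<in>space M. a < norm (B t \<omega> - B s \<omega>)} \<omega> \<le> (\<Sum>k\<in>UNIV. ennreal ((D * (B t \<omega> - B s \<omega>) $ k / a) ^ 20))"
    proof (cases "a < norm (B t \<omega> - B s \<omega>)")
      case True
      have "\<exists>k. a < D * \<bar>(B t \<omega> - B s \<omega>) $ k\<bar>"
      proof (rule ccontr)
        assume "\<nexists>k. a < D * \<bar>(B t \<omega> - B s \<omega>) $ k\<bar>"
        then have "\<bar>(B t \<omega> - B s \<omega>) $ k\<bar> \<le> a / D" for k using D by (simp add: not_less field_simps)
        then have "(\<Sum>k\<in>UNIV. \<bar>(B t \<omega> - B s \<omega>) $ k\<bar>) \<le> (\<Sum>k\<in>(UNIV::'n set). a / D)" by (intro sum_mono)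
        also have "\<dots> = a" by (simp add: D_def)
        finally show False using norm_le_l1_cart[of "B t \<omega> - B s \<omega>"] True by simp
      qed
      then obtain k where k: "a < D * \<bar>(B t \<omega> - B s \<omega>) $ k\<bar>" by blast
      have "1 \<le> D * \<bar>(B t \<omega> - B s \<omega>) $ k\<bar> / a" using k a by simp
      then have "1 \<le> (D * \<bar>(B t \<omega> - B s \<omega>) $ k\<bar> / a) ^ 20" by (rule one_le_power)
      also have "\<dots> = (D * (B t \<omega> - B s \<omega>) $ k / a) ^ 20"
        by (simp add: power_divide power_mult_distrib power_even_abs)
      finally have "1 \<le> ennreal ((D * (B t \<omega> - B s \<omega>) $ k / a) ^ 20)" by simp
      also have "\<dots> \<le> (\<Sum>k\<in>UNIV. ennreal ((D * (B t \<omega> - B s \<omega>) $ k / a) ^ 20))"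
        by (rule member_le_sum) auto
      finally show ?thesis by (auto simp: indicator_def)
    qed (simp add: indicator_def)
  qed
  also have "\<dots> = (\<Sum>k\<in>UNIV. \<integral>\<^sup>+\<omega>. ennreal ((D * (B t \<omega> - B s \<omega>) $ k / a) ^ 20) \<partial>M)"
  proof (rule nn_integral_sum)
    fix k
    have "(\<lambda>x. ennreal ((D * x / a) ^ 20)) \<in> borel_measurable borel" by measurable
    from measurable_compose[OF comp[of k] this]
    show "(\<lambda>\<omega>. ennreal ((D * (B t \<omega> - B s \<omega>) $ k / a) ^ 20)) \<in> borel_measurable M" .
  qed
  also have "\<dots> = ennreal (D * (D ^ 20 * c) * (sqrt (t - s) / a) ^ 20)"
    unfolding moment using c D a st by (simp add: D_def ennreal_of_nat_eq_real_of_nat mult.assoc flip: ennreal_mult)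
  finally show ?thesis
    using c D a st by (simp add: emeasure_eq_measure)
  qed
  then show ?thesis using c D by (intro exI[of _ "D * (D ^ 20 * c)"]) auto
qed

end


section \<open>Covering the Brownian path\<close>

text \<open>The thresholds of all depths \<open>l\<close> below the time scale \<open>4\<^sup>-\<^sup>n\<close> add up to \<open>2\<^sup>-\<^sup>n/2\<close>, so a point whose
  dyadic approximations make no bad step stays within half the radius of the starting point.\<close>

definition bad_steps :: "(real \<Rightarrow> 'a::real_normed_vector) \<Rightarrow> nat \<Rightarrow> nat \<Rightarrow> nat set" where
  "bad_steps w n l = {k. k < 2 ^ (2 * n + l) \<and>
     (1/2) ^ n * (4/5) ^ l / 10 <
       norm (w (real (2 * k + 1) / 2 ^ (2 * n + l + 1)) - w (real (2 * k) / 2 ^ (2 * n + l + 1)))}"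

lemma finite_bad_steps: "finite (bad_steps w n l)"
  by (rule finite_subset[of _ "{..<2 ^ (2 * n + l)}"]) (auto simp: bad_steps_def)

text \<open>The 4^n + 1 starting points and the bad steps, whose numbers sum geometrically to at
  most 2K * 4^n, give the count of centres. The thresholds use up half of the radius; the other half
  absorbs the distance from a late dyadic approximation to the point itself, by continuity.\<close>

lemma chaining_cover:
  fixes w :: "real \<Rightarrow> 'a::real_normed_vector"
  assumes w: "continuous_on {0..1} w" and K: "0 \<le> K"
    and bad: "\<And>l. real (card (bad_steps w n l)) \<le> K * 4 ^ n * (1/2) ^ l"
  shows "\<exists>T. finite T \<and> real (card T) \<le> (2 + 2 * K) * 4 ^ n \<and> w ` {0..1} \<subseteq> (\<Union>x\<in>T. cball x ((1/2) ^ n))"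
proof -
  \<comment> \<open>A cardinality below 1 is 0, so from some depth \<open>L\<close> on there are no
    bad steps and finitely many centres suffice.\<close>
  have "(\<lambda>l. K * 4 ^ n * (1/2) ^ l) \<longlonglongrightarrow> K * 4 ^ n * 0"
    by (intro tendsto_mult_left LIMSEQ_realpow_zero) auto
  then have "\<forall>\<^sub>F l in sequentially. K * 4 ^ n * (1/2) ^ l < 1"
    by (intro order_tendstoD) auto
  then obtain L where L: "\<And>l. l \<ge> L \<Longrightarrow> K * 4 ^ n * (1/2) ^ l < 1"
    unfolding eventually_sequentially by blast
  have bad0: "bad_steps w n l = {}" if "L \<le> l" for l
    using bad[of l] L[OF that] finite_bad_steps[of w n l] by (cases "card (bad_steps w n l)") auto
  define T1 where "T1 = (\<lambda>k. w (real k / 4 ^ n)) ` {..4 ^ n}"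
  define T2 where "T2 l = (\<lambda>k. w (real (2 * k + 1) / 2 ^ (2 * n + l + 1))) ` bad_steps w n l" for l
  define T where "T = T1 \<union> (\<Union>l<L. T2 l)"
  have finT: "finite T" unfolding T_def T1_def T2_def using finite_bad_steps by auto
  have "card T1 \<le> 4 ^ n + 1" unfolding T1_def by (rule order_trans[OF card_image_le]) auto
  then have c1: "real (card T1) \<le> 4 ^ n + 1" by (simp flip: of_nat_le_iff[where 'a=real])
  have "card (\<Union>l<L. T2 l) \<le> (\<Sum>l<L. card (T2 l))" by (rule card_UN_le) auto
  also have "\<dots> \<le> (\<Sum>l<L. card (bad_steps w n l))"
    unfolding T2_def by (intro sum_mono card_image_le finite_bad_steps)
  finally have "real (card (\<Union>l<L. T2 l)) \<le> (\<Sum>l<L. real (card (bad_steps w n l)))"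
    by (metis of_nat_le_iff of_nat_sum)
  also have "\<dots> \<le> (\<Sum>l<L. K * 4 ^ n * (1/2) ^ l)" using bad by (intro sum_mono)
  also have "\<dots> = K * 4 ^ n * (\<Sum>l<L. (1/2) ^ l)" by (simp add: sum_distrib_left)
  also have "(\<Sum>l<L. (1/2::real) ^ l) \<le> 2" by (simp add: geometric_sum)
  finally have c2: "real (card (\<Union>l<L. T2 l)) \<le> K * 4 ^ n * 2" using K by (simp add: mult_left_mono)
  have "card T \<le> card T1 + card (\<Union>l<L. T2 l)" unfolding T_def by (rule card_Un_le)
  then have "real (card T) \<le> real (card T1) + real (card (\<Union>l<L. T2 l))" by linarith
  also have "\<dots> \<le> (4 ^ n + 1) + K * 4 ^ n * 2" using c1 c2 by simp
  also have "\<dots> \<le> (2 + 2 * K) * 4 ^ n" using one_le_power[of "4::real" n] by (simp add: algebra_simps)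
  finally have card: "real (card T) \<le> (2 + 2 * K) * 4 ^ n" .
  have "\<exists>c\<in>T. dist c (w t) \<le> (1/2) ^ n" if t: "t \<in> {0..1}" for t
  proof (cases "t = 1")
    \<comment> \<open>The time 1 is its own starting point. It is treated apart because its index
      2^(2n+l) at depth l lies just outside the range of \<open>bad_steps\<close>.\<close>
    case True
    then have "w t \<in> T1" unfolding T1_def by (intro image_eqI[of _ _ "4 ^ n"]) auto
    then show ?thesis unfolding T_def by (intro bexI[of _ "w t"]) auto
  next
    case False
    with t have t01: "0 \<le> t" "t < 1" by auto
    \<comment> \<open>Binary expansion of \<open>t\<close>: a refinement either keeps the point
      \<open>s l\<close> (digit 0) or moves it to the midpoint of its dyadic interval (digit 1), and
      \<open>bad_steps\<close> records the long moves of the second kind.\<close>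
    define k where "k l = nat \<lfloor>2 ^ (2 * n + l) * t\<rfloor>" for l
    define s where "s l = real (k l) / 2 ^ (2 * n + l)" for l
    have k1: "real (k l) \<le> 2 ^ (2 * n + l) * t" "2 ^ (2 * n + l) * t < real (k l) + 1" for l
      using t01 unfolding k_def by (simp_all add: of_nat_nat)
    have kl: "k l < 2 ^ (2 * n + l)" for l
    proof -
      have "2 ^ (2 * n + l) * t < 2 ^ (2 * n + l) * 1" using t01 by (intro mult_strict_left_mono) auto
      then have "real (k l) < 2 ^ (2 * n + l)" using k1(1)[of l] by linarith
      then show ?thesis by (metis of_nat_less_iff of_nat_numeral of_nat_power)
    qed
    have kS: "k (Suc l) = 2 * k l \<or> k (Suc l) = 2 * k l + 1" for l
      using k1[of l] k1[of "Suc l"] by simp linarith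
    have st: "s l \<le> t" "t - s l \<le> (1/2) ^ l" for l
    proof -
      show "s l \<le> t" using k1(1)[of l] by (simp add: s_def divide_le_eq mult.commute)
      have "t - s l = (2 ^ (2 * n + l) * t - real (k l)) / 2 ^ (2 * n + l)" by (simp add: s_def field_simps)
      also have "\<dots> \<le> 1 / 2 ^ (2 * n + l)" using k1(2)[of l] by (intro divide_right_mono) auto
      also have "\<dots> \<le> 1 / 2 ^ l" by (intro divide_left_mono power_increasing) auto
      finally show "t - s l \<le> (1/2) ^ l" by (simp add: power_divide)
    qed
    have s0: "0 \<le> s l" for l by (simp add: s_def)
    define a where "a i = (1/2) ^ n * (4/5) ^ i / (10::real)" for i
    \<comment> \<open>The invariant allows the centre to change with \<open>l\<close>: a good step
      adds its threshold to the distance, while a bad step makes the new point a centre and resets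
      the distance to 0.\<close>
    have chain: "\<exists>c\<in>T. dist c (w (s l)) \<le> (\<Sum>i<l. a i)" for l
    proof (induction l)
      case 0
      have "4 ^ n = (2::real) ^ (2 * n)" by (simp add: power_mult)
      moreover have "k 0 \<le> 4 ^ n" using kl[of 0] by (simp add: power_mult)
      ultimately have "w (s 0) \<in> T1" unfolding T1_def s_def by (intro image_eqI[of _ _ "k 0"]) auto
      then show ?case unfolding T_def by (intro bexI[of _ "w (s 0)"]) auto
    next
      case (Suc l)
      then obtain c where c: "c \<in> T" "dist c (w (s l)) \<le> (\<Sum>i<l. a i)" by blast
      have sl: "s l = real (2 * k l) / 2 ^ (2 * n + l + 1)" by (simp add: s_def)
      have a0: "0 \<le> a l" by (simp add: a_def)
      from kS[of l] consider "k (Suc l) = 2 * k l" | "k (Suc l) = 2 * k l + 1" by blast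
      then show ?case
      proof cases
        case 1
        then have "s (Suc l) = s l" by (simp add: s_def)
        then show ?thesis using c a0 by (intro bexI[of _ c]) auto
      next
        case 2
        then have sS: "s (Suc l) = real (2 * k l + 1) / 2 ^ (2 * n + l + 1)" by (simp add: s_def)
        show ?thesis
        proof (cases "k l \<in> bad_steps w n l")
          case True
          then have "l < L" using bad0[of l] by (cases "l < L") auto
          moreover have "w (s (Suc l)) \<in> T2 l" unfolding T2_def sS using True by (rule imageI)
          ultimately have "w (s (Suc l)) \<in> T" by (auto simp: T_def)
          moreover have "0 \<le> (\<Sum>i<Suc l. a i)" by (intro sum_nonneg) (auto simp: a_def)
          ultimately show ?thesis by (intro bexI[of _ "w (s (Suc l))"]) auto
        next
          case False
          then have "norm (w (s (Suc l)) - w (s l)) \<le> a l"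
            using kl[of l] unfolding bad_steps_def sS sl a_def by (simp del: of_nat_add of_nat_mult of_nat_Suc add: not_less)
          then have "dist (w (s l)) (w (s (Suc l))) \<le> a l" by (simp add: dist_norm norm_minus_commute)
          then show ?thesis using c dist_triangle[of c "w (s (Suc l))" "w (s l)"]
            by (intro bexI[of _ c]) auto
        qed
      qed
    qed
    have asum: "(\<Sum>i<l. a i) \<le> (1/2) ^ n / 2" for l
    proof -
      have "(\<Sum>i<l. a i) = (1/2) ^ n / 10 * (\<Sum>i<l. (4/5) ^ i)" by (simp add: a_def sum_distrib_left)
      also have "(\<Sum>i<l. (4/5::real) ^ i) \<le> 5" by (simp add: geometric_sum)
      finally show ?thesis by (simp add: mult_left_mono)
    qed
    have "s \<longlonglongrightarrow> t"
    proof (rule LIMSEQ_I)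
      fix e :: real assume "0 < e"
      then obtain N where N: "(1/2) ^ N < e" using real_arch_pow_inv[of e "1/2"] by auto
      have "norm (s l - t) < e" if "N \<le> l" for l
      proof -
        have "(1/2::real) ^ l \<le> (1/2) ^ N" using that by (intro power_decreasing) auto
        then show ?thesis using st[of l] N unfolding real_norm_def by linarith
      qed
      then show "\<exists>N. \<forall>l\<ge>N. norm (s l - t) < e" by blast
    qed
    then have "(\<lambda>l. w (s l)) \<longlonglongrightarrow> w t"
      using w t s0 st(1) t01 by (intro continuous_on_tendsto_compose[OF w]) (auto intro!: eventuallyI intro: order_trans[OF st(1)])
    then obtain l where l: "dist (w (s l)) (w t) < (1/2) ^ n / 2"
      using LIMSEQ_D[of _ "w t" "(1/2) ^ n / 2"] by (metis dist_norm half_gt_zero order_refl zero_less_power zero_less_divide_1_iff zero_less_numeral)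
    obtain c where "c \<in> T" "dist c (w (s l)) \<le> (\<Sum>i<l. a i)" using chain by blast
    then show ?thesis using asum[of l] l dist_triangle[of c "w t" "w (s l)"] by (intro bexI[of _ c]) auto
  qed
  then show ?thesis using finT card by (intro exI[of _ T]) (auto simp: dist_commute)
qed

section \<open>Counting long dyadic steps\<close>

context brownian_motion begin

text \<open>The mean number of bad steps is at most C * 4^n * 5^(-l), and its variance is no larger.
  The target has the weaker decay 2^(-l), which leaves room to sum the squared relative deviations
  over all \<open>n\<close> and \<open>l\<close>.\<close>

lemma AE_bad_steps_bounded:
  "AE \<omega> in M. \<exists>K\<ge>0. \<forall>n l. real (card (bad_steps (\<lambda>t. B t \<omega>) n l)) \<le> K * 4 ^ n * (1/2) ^ l"
proof -
  define u where "u n l k = real (2 * k) / 2 ^ (2 * n + l + 1)" for n l k :: nat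
  define v where "v n l k = real (2 * k + 1) / 2 ^ (2 * n + l + 1)" for n l k :: nat
  define a :: "nat \<Rightarrow> nat \<Rightarrow> real" where "a n l = (1/2) ^ n * (4/5) ^ l / 10" for n l
  define A where "A n l k = {\<omega>\<in>space M. a n l < norm (B (v n l k) \<omega> - B (u n l k) \<omega>)}" for n l k
  define I :: "nat \<Rightarrow> nat \<Rightarrow> nat set" where "I n l = {..<2 ^ (2 * n + l)}" for n l
  define p where "p n l = (\<Sum>k\<in>I n l. prob (A n l k))" for n l
  define S where "S n l \<omega> = (\<Sum>k\<in>I n l. indicator (A n l k) \<omega> :: real)" for n l \<omega>
  have uv: "0 \<le> u n l k" "u n l k < v n l k" "v n l k - u n l k = 1 / 2 ^ (2 * n + l + 1)" for n l k
    unfolding u_def v_def diff_divide_distrib[symmetric]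
    by (simp, rule divide_strict_right_mono, simp_all)
  have v1: "v n l k \<le> 1" if "k \<in> I n l" for n l k
  proof -
    have "k + 1 \<le> 2 ^ (2 * n + l)" using that by (simp add: I_def)
    then have "2 * k + 1 \<le> 2 ^ (2 * n + l + 1)" by simp
    then have "real (2 * k + 1) \<le> 2 ^ (2 * n + l + 1)" by (metis of_nat_le_iff of_nat_numeral of_nat_power)
    then show ?thesis by (simp add: v_def)
  qed
  have Am: "A n l k \<in> events" if "k \<in> I n l" for n l k
  proof -
    have [measurable]: "B (v n l k) \<in> borel_measurable M" "B (u n l k) \<in> borel_measurable M"
      using uv[of n l k] v1[OF that] by (auto intro!: measurable_B)
    show ?thesis unfolding A_def by measurable
  qed
  have SB: "S n l \<omega> = real (card (bad_steps (\<lambda>t. B t \<omega>) n l))" if "\<omega> \<in> space M" for n l \<omega>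
  proof -
    have "S n l \<omega> = (\<Sum>k\<in>I n l. indicator (bad_steps (\<lambda>t. B t \<omega>) n l) k)"
      unfolding S_def using that
      by (intro sum.cong) (auto simp: A_def bad_steps_def I_def indicator_def u_def v_def a_def)
    also have "\<dots> = real (card (bad_steps (\<lambda>t. B t \<omega>) n l))"
      by (simp add: indicator_def I_def sum.If_cases) (auto simp: bad_steps_def intro!: arg_cong[of _ _ card])
    finally show ?thesis .
  qed
  obtain C0 where C0: "0 \<le> C0"
    "\<And>s t a. 0 \<le> s \<Longrightarrow> s < t \<Longrightarrow> t \<le> 1 \<Longrightarrow> 0 < a \<Longrightarrow> prob {\<omega>\<in>space M. a < norm (B t \<omega> - B s \<omega>)} \<le> C0 * (sqrt (t - s) / a) ^ 20"
    using prob_increment_large by blast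
  \<comment> \<open>Step length 2^(-2n-l-1) over squared threshold 4^(-n) (16/25)^l / 100 is 50 *
    (25/32)^l. The 20th moment takes the 10th power of this, and 10 is the first exponent that
    brings the power of 25/32 below 1/10.\<close>
  define C where "C = C0 * 50 ^ 10"
  have C: "0 \<le> C" using C0 by (simp add: C_def)
  have pA: "prob (A n l k) \<le> C * (1/10) ^ l" if k: "k \<in> I n l" for n l k
  proof -
    have apos: "a n l > 0" by (simp add: a_def)
    have "(sqrt (v n l k - u n l k) / a n l)\<^sup>2 = (1 / 2 ^ (2 * n + l + 1)) / (a n l)\<^sup>2"
      unfolding uv(3) by (simp add: power_divide)
    also have "(a n l)\<^sup>2 = (1/4) ^ n * (16/25) ^ l / 100"
    proof -
      have "(1/4::real) ^ n = (1/2) ^ n * (1/2) ^ n" "(16/25::real) ^ l = (4/5) ^ l * (4/5) ^ l"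
        by (simp_all flip: power_mult_distrib)
      then show ?thesis by (simp add: a_def power2_eq_square)
    qed
    also have "(1 / 2 ^ (2 * n + l + 1)) / ((1/4) ^ n * (16/25) ^ l / 100) = 50 * (25/32 :: real) ^ l"
    proof -
      have "(32::real) ^ l = 2 ^ l * 16 ^ l" by (simp flip: power_mult_distrib)
      then show ?thesis by (simp add: power_add power_mult power_divide)
    qed
    finally have sq: "(sqrt (v n l k - u n l k) / a n l)\<^sup>2 = 50 * (25/32) ^ l" .
    have "(sqrt (v n l k - u n l k) / a n l) ^ 20 = ((sqrt (v n l k - u n l k) / a n l)\<^sup>2) ^ 10"
      by (simp only: power_mult[symmetric]) simp
    also have "\<dots> = 50 ^ 10 * ((25/32) ^ 10) ^ l"
      unfolding sq power_mult_distrib power_mult[symmetric] by (simp only: mult.commute)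
    also have "\<dots> \<le> 50 ^ 10 * (1/10) ^ l"
      by (intro mult_left_mono power_mono) (auto simp: power_divide)
    finally have e: "(sqrt (v n l k - u n l k) / a n l) ^ 20 \<le> 50 ^ 10 * (1/10) ^ l" .
    have "prob (A n l k) \<le> C0 * (sqrt (v n l k - u n l k) / a n l) ^ 20"
      unfolding A_def using uv[of n l k] v1[OF k] apos by (intro C0) auto
    also have "\<dots> \<le> C0 * (50 ^ 10 * (1/10) ^ l)" using e C0 by (intro mult_left_mono)
    finally show ?thesis by (simp add: C_def)
  qed
  have p0: "0 \<le> p n l" for n l by (auto simp: p_def intro: sum_nonneg)
  have p: "p n l \<le> C * 4 ^ n * (1/5) ^ l" for n l
  proof -
    have "p n l \<le> (\<Sum>k\<in>I n l. C * (1/10) ^ l)" unfolding p_def by (intro sum_mono pA)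
    also have "\<dots> = 2 ^ (2 * n + l) * (C * (1/10) ^ l)" by (simp add: I_def)
    also have "\<dots> = C * 4 ^ n * (2 ^ l * (1/10) ^ l)" by (simp add: power_add power_mult)
    also have "2 ^ l * (1/10) ^ l = (1/5 :: real) ^ l" by (simp flip: power_mult_distrib)
    finally show ?thesis .
  qed
  have var: "(\<integral>\<^sup>+\<omega>. ennreal ((S n l \<omega> - p n l)\<^sup>2) \<partial>M) \<le> ennreal (p n l)" for n l
    unfolding S_def p_def
  proof (rule variance_pairwise_indep_events)
    have lt: "prob (A n l i \<inter> A n l j) = prob (A n l i) * prob (A n l j)" if ij: "i \<in> I n l" "j \<in> I n l" "i < j" for i j
    proof -
      let ?U = "{x :: real^'n. a n l < norm x}"
      have "real (2 * i + 1) \<le> real (2 * j)" using ij(3) by simp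
      then have le: "v n l i \<le> u n l j" unfolding u_def v_def by (intro divide_right_mono) auto
      have "A n l i \<inter> A n l j = {\<omega>\<in>space M. B (v n l i) \<omega> - B (u n l i) \<omega> \<in> ?U \<and> B (v n l j) \<omega> - B (u n l j) \<omega> \<in> ?U}"
        by (auto simp: A_def)
      moreover have "prob \<dots> = prob {\<omega>\<in>space M. B (v n l i) \<omega> - B (u n l i) \<omega> \<in> ?U} * prob {\<omega>\<in>space M. B (v n l j) \<omega> - B (u n l j) \<omega> \<in> ?U}"
        using uv[of n l i] uv[of n l j] le v1[OF ij(2)] by (intro prob_increments_indep) auto
      ultimately show ?thesis by (simp add: A_def)
    qed
    show "prob (A n l i \<inter> A n l j) = prob (A n l i) * prob (A n l j)" if "i \<in> I n l" "j \<in> I n l" "i \<noteq> j" for i j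
      using lt[of i j] lt[of j i] that by (cases i j rule: linorder_cases) (auto simp: Int_commute mult.commute)
  qed (auto simp: I_def intro!: Am)
  have Sm[measurable]: "S n l \<in> borel_measurable M" for n l
    unfolding S_def[abs_def] using Am by (intro borel_measurable_sum borel_measurable_indicator) auto
  \<comment> \<open>The weight is the inverse square of the target 4^n * 2^(-l), so a bound K on
    \<open>g n\<close> turns into a deviation of at most sqrt K times the target.\<close>
  define g where "g n \<omega> = (\<Sum>l. ennreal (4 ^ l / 16 ^ n * (S n l \<omega> - p n l)\<^sup>2))" for n \<omega>
  have gm[measurable]: "g n \<in> borel_measurable M" for n unfolding g_def[abs_def] by measurable
  have "(\<integral>\<^sup>+\<omega>. g n \<omega> \<partial>M) \<le> ennreal (5 * C * (1/4) ^ n)" for n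
  proof -
    have "(\<integral>\<^sup>+\<omega>. g n \<omega> \<partial>M) = (\<Sum>l. \<integral>\<^sup>+\<omega>. ennreal (4 ^ l / 16 ^ n * (S n l \<omega> - p n l)\<^sup>2) \<partial>M)"
      unfolding g_def by (rule nn_integral_suminf) measurable
    also have "\<dots> \<le> (\<Sum>l. ennreal (C * (1/4) ^ n * (4/5) ^ l))"
    proof (rule suminf_le)
      fix l
      have "(\<integral>\<^sup>+\<omega>. ennreal (4 ^ l / 16 ^ n * (S n l \<omega> - p n l)\<^sup>2) \<partial>M) = ennreal (4 ^ l / 16 ^ n) * (\<integral>\<^sup>+\<omega>. ennreal ((S n l \<omega> - p n l)\<^sup>2) \<partial>M)"
        by (subst nn_integral_cmult[symmetric]) (auto simp flip: ennreal_mult)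
      also have "\<dots> \<le> ennreal (4 ^ l / 16 ^ n) * ennreal (C * 4 ^ n * (1/5) ^ l)"
        using var[of n l] p[of n l] by (intro mult_left_mono) (auto intro: order_trans ennreal_leI)
      also have "\<dots> = ennreal (4 ^ l / 16 ^ n * (C * 4 ^ n * (1/5) ^ l))"
        using C by (simp flip: ennreal_mult)
      also have "4 ^ l / 16 ^ n * (C * 4 ^ n * (1/5) ^ l) = C * (1/4) ^ n * (4/5) ^ l"
      proof -
        have "(16::real) ^ n = 4 ^ n * 4 ^ n" by (simp flip: power_mult_distrib)
        then show ?thesis by (simp add: power_divide)
      qed
      finally show "(\<integral>\<^sup>+\<omega>. ennreal (4 ^ l / 16 ^ n * (S n l \<omega> - p n l)\<^sup>2) \<partial>M) \<le> ennreal (C * (1/4) ^ n * (4/5) ^ l)" .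
    qed auto
    also have "\<dots> = ennreal (\<Sum>l. C * (1/4) ^ n * (4/5) ^ l)"
      using C by (intro suminf_ennreal2) (auto intro!: summable_mult summable_geometric)
    also have "(\<Sum>l. C * (1/4) ^ n * (4/5 :: real) ^ l) = 5 * C * (1/4) ^ n"
      by (subst suminf_mult) (auto simp: suminf_geometric intro!: summable_geometric)
    finally show ?thesis .
  qed
  then have "(\<Sum>n. \<integral>\<^sup>+\<omega>. g n \<omega> \<partial>M) < \<infinity>"
    by (rule suminf_ennreal_less_top) (use C in \<open>auto intro!: summable_mult summable_geometric\<close>)
  from AE_bounded_if_summable_nn_integral[OF gm this] AE_space
  show ?thesis
  proof eventually_elim
    case (elim \<omega>)
    then obtain K where K: "0 \<le> K" "\<And>n. g n \<omega> \<le> ennreal K" by blast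
    have "S n l \<omega> \<le> (C + sqrt K) * 4 ^ n * (1/2) ^ l" for n l
    proof -
      have "ennreal (4 ^ l / 16 ^ n * (S n l \<omega> - p n l)\<^sup>2) \<le> g n \<omega>"
        unfolding g_def by (rule ennreal_le_suminf)
      with K have "4 ^ l / 16 ^ n * (S n l \<omega> - p n l)\<^sup>2 \<le> K"
        by (meson ennreal_le_iff order_trans)
      moreover have "4 ^ l / 16 ^ n * (S n l \<omega> - p n l)\<^sup>2 = (2 ^ l / 4 ^ n * (S n l \<omega> - p n l))\<^sup>2"
      proof -
        have "(16::real) ^ n = 4 ^ n * 4 ^ n" "(4::real) ^ l = 2 ^ l * 2 ^ l" by (simp_all flip: power_mult_distrib)
        then show ?thesis by (simp add: power2_eq_square)
      qed
      ultimately have "2 ^ l / 4 ^ n * (S n l \<omega> - p n l) \<le> sqrt K"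
        using real_le_rsqrt by metis
      then have "S n l \<omega> - p n l \<le> sqrt K * 4 ^ n * (1/2) ^ l"
        by (simp add: field_simps power_divide)
      moreover have "p n l \<le> C * 4 ^ n * (1/2) ^ l"
        using C by (intro order_trans[OF p] mult_left_mono power_mono) auto
      ultimately show ?thesis by (simp add: algebra_simps)
    qed
    then show ?case using SB[of \<omega>] elim(2) C K(1) by (intro exI[of _ "C + sqrt K"]) auto
  qed
qed

end


section \<open>The occupation measure\<close>

text \<open>Continuous counterpart of the variance bound for events. By Fubini the second moment is
  the integral of joint probabilities over pairs (p, p'). Pairs outside \<open>dep\<close>
  contribute at most the squared mean; on \<open>dep\<close> the joint probability is bounded by
  that of p alone, and integrating over p' gives the factor \<open>e\<close>.\<close>

lemma (in prob_space) variance_measure_section: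
  fixes P :: "'d \<Rightarrow> 'a \<Rightarrow> bool"
  assumes D: "prob_space D"
    and P[measurable]: "Measurable.pred (D \<Otimes>\<^sub>M M) (\<lambda>(p, \<omega>). P p \<omega>)"
    and dep[measurable]: "Measurable.pred (D \<Otimes>\<^sub>M D) (\<lambda>(p, p'). dep p p')"
    and ind: "\<And>p p'. p \<in> space D \<Longrightarrow> p' \<in> space D \<Longrightarrow> \<not> dep p p' \<Longrightarrow>
      prob {\<omega>\<in>space M. P p \<omega> \<and> P p' \<omega>} \<le> prob {\<omega>\<in>space M. P p \<omega>} * prob {\<omega>\<in>space M. P p' \<omega>}"
    and e: "0 \<le> e" "\<And>p. p \<in> space D \<Longrightarrow> emeasure D {p'\<in>space D. dep p p'} \<le> ennreal e"
  defines "X \<equiv> (\<lambda>\<omega>. measure D {p\<in>space D. P p \<omega>})"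
  shows "X \<in> borel_measurable M"
    and "ennreal (expectation X) = (\<integral>\<^sup>+p. emeasure M {\<omega>\<in>space M. P p \<omega>} \<partial>D)"
    and "(\<integral>\<^sup>+\<omega>. ennreal ((X \<omega> - expectation X)\<^sup>2) \<partial>M) \<le> ennreal (e * expectation X)"
proof -
  interpret D: prob_space D by fact
  interpret DM: pair_prob_space D M ..
  \<comment> \<open>Indicators with values in \<open>ennreal\<close> let the integrals be exchanged
    without integrability conditions.\<close>
  define H where "H p \<omega> = (if P p \<omega> then 1 else 0 :: ennreal)" for p \<omega>
  have [measurable]: "(\<lambda>(p, \<omega>). H p \<omega>) \<in> borel_measurable (D \<Otimes>\<^sub>M M)"
    unfolding H_def by measurable
  have XH: "ennreal (X \<omega>) = (\<integral>\<^sup>+p. H p \<omega> \<partial>D)" if [measurable]: "\<omega> \<in> space M" for \<omega>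
  proof -
    have "(\<integral>\<^sup>+p. H p \<omega> \<partial>D) = (\<integral>\<^sup>+p. indicator {p\<in>space D. P p \<omega>} p \<partial>D)"
      by (intro nn_integral_cong) (auto simp: H_def indicator_def)
    also have "\<dots> = emeasure D {p\<in>space D. P p \<omega>}"
      by (rule nn_integral_indicator) measurable
    finally show ?thesis by (simp add: X_def D.emeasure_eq_measure)
  qed
  have X0: "0 \<le> X \<omega>" "X \<omega> \<le> 1" for \<omega> by (auto simp: X_def)
  have Xe: "X \<omega> = enn2real (\<integral>\<^sup>+p. H p \<omega> \<partial>D)" if "\<omega> \<in> space M" for \<omega>
    unfolding XH[OF that, symmetric] using X0 by simp
  have "(\<lambda>\<omega>. enn2real (\<integral>\<^sup>+p. H p \<omega> \<partial>D)) \<in> borel_measurable M" by measurable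
  then show Xm[measurable]: "X \<in> borel_measurable M"
    by (subst measurable_cong[OF Xe])
  define q where "q p = (\<integral>\<^sup>+\<omega>. H p \<omega> \<partial>M)" for p
  have [measurable]: "q \<in> borel_measurable D" unfolding q_def[abs_def] by measurable
  have q: "q p = emeasure M {\<omega>\<in>space M. P p \<omega>}" if [measurable]: "p \<in> space D" for p
  proof -
    have "q p = (\<integral>\<^sup>+\<omega>. indicator {\<omega>\<in>space M. P p \<omega>} \<omega> \<partial>M)"
      unfolding q_def by (intro nn_integral_cong) (auto simp: H_def indicator_def)
    also have "\<dots> = emeasure M {\<omega>\<in>space M. P p \<omega>}"
      by (rule nn_integral_indicator) measurable
    finally show ?thesis .
  qed
  have intX: "integrable M X" by (rule integrable_const_bound[where B=1]) (use X0 in auto)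
  have intX2: "integrable M (\<lambda>\<omega>. (X \<omega>)\<^sup>2)"
    by (rule integrable_const_bound[where B=1]) (use X0 in \<open>auto simp: power_le_one\<close>)
  define m where "m = expectation X"
  have m0: "0 \<le> m" unfolding m_def using X0 by (intro integral_nonneg_AE) auto
  have m: "ennreal m = (\<integral>\<^sup>+p. q p \<partial>D)"
  proof -
    have "ennreal m = (\<integral>\<^sup>+\<omega>. ennreal (X \<omega>) \<partial>M)"
      unfolding m_def using intX X0 by (intro nn_integral_eq_integral[symmetric]) auto
    also have "\<dots> = (\<integral>\<^sup>+\<omega>. \<integral>\<^sup>+p. H p \<omega> \<partial>D \<partial>M)" by (intro nn_integral_cong XH)
    also have "\<dots> = (\<integral>\<^sup>+p. q p \<partial>D)" unfolding q_def by (rule DM.Fubini') measurable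
    finally show ?thesis .
  qed
  also have "(\<integral>\<^sup>+p. q p \<partial>D) = (\<integral>\<^sup>+p. emeasure M {\<omega>\<in>space M. P p \<omega>} \<partial>D)"
    by (intro nn_integral_cong q)
  finally show "ennreal (expectation X) = (\<integral>\<^sup>+p. emeasure M {\<omega>\<in>space M. P p \<omega>} \<partial>D)"
    by (simp add: m_def)
  have HH: "(\<integral>\<^sup>+\<omega>. H p \<omega> * H p' \<omega> \<partial>M) \<le> q p * q p' + q p * (if dep p p' then 1 else 0)" if pp[measurable]: "p \<in> space D" "p' \<in> space D" for p p'
  proof (cases "dep p p'")
    case True
    have "(\<integral>\<^sup>+\<omega>. H p \<omega> * H p' \<omega> \<partial>M) \<le> q p" unfolding q_def by (intro nn_integral_mono) (auto simp: H_def)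
    then show ?thesis using True by (simp add: add_increasing)
  next
    case False
    have "(\<integral>\<^sup>+\<omega>. H p \<omega> * H p' \<omega> \<partial>M) = (\<integral>\<^sup>+\<omega>. indicator {\<omega>\<in>space M. P p \<omega> \<and> P p' \<omega>} \<omega> \<partial>M)"
      by (intro nn_integral_cong) (auto simp: H_def indicator_def)
    also have "\<dots> = emeasure M {\<omega>\<in>space M. P p \<omega> \<and> P p' \<omega>}"
      by (rule nn_integral_indicator) measurable
    also have "\<dots> \<le> q p * q p'"
      using ind[OF pp False] by (simp add: q pp emeasure_eq_measure flip: ennreal_mult)
    finally show ?thesis using False by simp
  qed
  have "ennreal (expectation (\<lambda>\<omega>. (X \<omega>)\<^sup>2)) = (\<integral>\<^sup>+\<omega>. ennreal ((X \<omega>)\<^sup>2) \<partial>M)"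
    using intX2 by (intro nn_integral_eq_integral[symmetric]) auto
  also have "\<dots> = (\<integral>\<^sup>+\<omega>. \<integral>\<^sup>+p. \<integral>\<^sup>+p'. H p \<omega> * H p' \<omega> \<partial>D \<partial>D \<partial>M)"
  proof (intro nn_integral_cong)
    fix \<omega> assume w[measurable]: "\<omega> \<in> space M"
    have "ennreal ((X \<omega>)\<^sup>2) = (\<integral>\<^sup>+p. H p \<omega> \<partial>D) * (\<integral>\<^sup>+p. H p \<omega> \<partial>D)"
      using X0 by (simp add: power2_eq_square ennreal_mult XH[OF w])
    also have "\<dots> = (\<integral>\<^sup>+p. H p \<omega> * (\<integral>\<^sup>+p. H p \<omega> \<partial>D) \<partial>D)"
      by (rule nn_integral_multc[symmetric]) measurable
    also have "\<dots> = (\<integral>\<^sup>+p. \<integral>\<^sup>+p'. H p \<omega> * H p' \<omega> \<partial>D \<partial>D)"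
      by (intro nn_integral_cong nn_integral_cmult[symmetric]) measurable
    finally show "ennreal ((X \<omega>)\<^sup>2) = (\<integral>\<^sup>+p. \<integral>\<^sup>+p'. H p \<omega> * H p' \<omega> \<partial>D \<partial>D)" .
  qed
  also have "\<dots> = (\<integral>\<^sup>+p. \<integral>\<^sup>+\<omega>. \<integral>\<^sup>+p'. H p \<omega> * H p' \<omega> \<partial>D \<partial>M \<partial>D)"
    by (rule DM.Fubini') measurable
  also have "\<dots> = (\<integral>\<^sup>+p. \<integral>\<^sup>+p'. \<integral>\<^sup>+\<omega>. H p \<omega> * H p' \<omega> \<partial>M \<partial>D \<partial>D)"
    by (intro nn_integral_cong DM.Fubini') measurable
  also have "\<dots> \<le> (\<integral>\<^sup>+p. \<integral>\<^sup>+p'. q p * q p' + q p * (if dep p p' then 1 else 0) \<partial>D \<partial>D)"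
    by (intro nn_integral_mono HH)
  also have "\<dots> \<le> (\<integral>\<^sup>+p. q p * ennreal m + q p * ennreal e \<partial>D)"
  proof (intro nn_integral_mono)
    fix p assume p[measurable]: "p \<in> space D"
    have "(\<integral>\<^sup>+p'. (if dep p p' then 1 else 0) \<partial>D) = (\<integral>\<^sup>+p'. indicator {p'\<in>space D. dep p p'} p' \<partial>D)"
      by (intro nn_integral_cong) (auto simp: indicator_def)
    also have "\<dots> = emeasure D {p'\<in>space D. dep p p'}"
      by (rule nn_integral_indicator) measurable
    also have "\<dots> \<le> ennreal e" by (rule e(2)[OF p])
    finally have *: "(\<integral>\<^sup>+p'. (if dep p p' then 1 else 0) \<partial>D) \<le> ennreal e" .
    have "(\<integral>\<^sup>+p'. q p * q p' + q p * (if dep p p' then 1 else 0) \<partial>D) =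
        (\<integral>\<^sup>+p'. q p * q p' \<partial>D) + (\<integral>\<^sup>+p'. q p * (if dep p p' then 1 else 0) \<partial>D)"
      by (rule nn_integral_add) measurable
    also have "(\<integral>\<^sup>+p'. q p * q p' \<partial>D) = q p * ennreal m"
      unfolding m by (rule nn_integral_cmult) measurable
    also have "(\<integral>\<^sup>+p'. q p * (if dep p p' then 1 else 0) \<partial>D) = q p * (\<integral>\<^sup>+p'. (if dep p p' then 1 else 0) \<partial>D)"
      by (rule nn_integral_cmult) measurable
    finally show "(\<integral>\<^sup>+p'. q p * q p' + q p * (if dep p p' then 1 else 0) \<partial>D) \<le> q p * ennreal m + q p * ennreal e"
      using * by (simp add: mult_left_mono add_left_mono)
  qed
  also have "\<dots> = (\<integral>\<^sup>+p. q p * ennreal m \<partial>D) + (\<integral>\<^sup>+p. q p * ennreal e \<partial>D)"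
    by (rule nn_integral_add) measurable
  also have "\<dots> = ennreal m * ennreal m + ennreal m * ennreal e"
    by (simp add: nn_integral_multc m)
  also have "\<dots> = ennreal (m\<^sup>2 + e * m)"
    using m0 e(1) by (simp add: power2_eq_square mult.commute flip: ennreal_mult ennreal_plus)
  finally have "expectation (\<lambda>\<omega>. (X \<omega>)\<^sup>2) \<le> m\<^sup>2 + e * m"
    using m0 e(1) by (subst (asm) ennreal_le_iff) auto
  then have "variance X \<le> e * m"
    unfolding variance_eq[OF intX intX2] by (simp add: m_def)
  moreover have "(\<integral>\<^sup>+\<omega>. ennreal ((X \<omega> - expectation X)\<^sup>2) \<partial>M) = ennreal (variance X)"
  proof (rule nn_integral_eq_integral)
    have "(\<lambda>\<omega>. (X \<omega> - expectation X)\<^sup>2) = (\<lambda>\<omega>. (X \<omega>)\<^sup>2 - 2 * expectation X * X \<omega> + (expectation X)\<^sup>2)"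
      by (auto simp: power2_eq_square algebra_simps)
    then show "integrable M (\<lambda>\<omega>. (X \<omega> - expectation X)\<^sup>2)"
      using intX intX2 by simp
  qed simp
  ultimately show "(\<integral>\<^sup>+\<omega>. ennreal ((X \<omega> - expectation X)\<^sup>2) \<partial>M) \<le> ennreal (e * expectation X)"
    by (simp add: m_def ennreal_leI)
qed

text \<open>Rounding the time down to a dyadic grid leaves countably many time values, so each
  approximation is jointly measurable; continuity of the paths gives convergence.\<close>

lemma jointly_measurable_continuous:
  fixes W :: "real \<Rightarrow> 'a \<Rightarrow> 'b::euclidean_space"
  assumes m: "\<And>t. W t \<in> borel_measurable M" and c: "\<And>\<omega>. \<omega> \<in> space M \<Longrightarrow> continuous_on UNIV (\<lambda>t. W t \<omega>)"
  shows "(\<lambda>(t, \<omega>). W t \<omega>) \<in> borel_measurable (borel \<Otimes>\<^sub>M M)"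
proof (rule borel_measurable_LIMSEQ_metric)
  fix n :: nat
  let ?f = "\<lambda>(t :: real, \<omega>). W (of_int \<lfloor>2 ^ n * t\<rfloor> / 2 ^ n) \<omega>"
  have "(\<lambda>x. W (of_int \<lfloor>2 ^ n * fst x :: real\<rfloor> / 2 ^ n) (snd x)) \<in> borel_measurable (borel \<Otimes>\<^sub>M M)"
  proof (rule measurable_compose_countable[where f="\<lambda>i x. W (of_int i / 2 ^ n) (snd x)" and g="\<lambda>x. \<lfloor>2 ^ n * fst x :: real\<rfloor>"])
    show "(\<lambda>x. W (of_int i / 2 ^ n) (snd x)) \<in> borel_measurable (borel \<Otimes>\<^sub>M M)" for i
      by (rule measurable_compose[OF measurable_snd m])
  qed measurable
  then show "?f \<in> borel_measurable (borel \<Otimes>\<^sub>M M)" by (simp add: case_prod_beta')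
next
  fix x :: "real \<times> 'a" assume "x \<in> space (borel \<Otimes>\<^sub>M M)"
  then obtain t \<omega> where x: "x = (t, \<omega>)" "\<omega> \<in> space M" by (auto simp: space_pair_measure)
  have "(\<lambda>n. of_int \<lfloor>2 ^ n * t\<rfloor> / 2 ^ n) \<longlonglongrightarrow> t"
  proof (rule LIMSEQ_I)
    fix e :: real assume "0 < e"
    then obtain N where N: "(1/2) ^ N < e" using real_arch_pow_inv[of e "1/2"] by auto
    have "norm (of_int \<lfloor>2 ^ n * t\<rfloor> / 2 ^ n - t) < e" if "N \<le> n" for n
    proof -
      have "of_int \<lfloor>2 ^ n * t\<rfloor> / 2 ^ n - t = (of_int \<lfloor>2 ^ n * t\<rfloor> - 2 ^ n * t) / 2 ^ n" by (simp add: field_simps)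
      then have "norm (of_int \<lfloor>2 ^ n * t\<rfloor> / 2 ^ n - t) = \<bar>of_int \<lfloor>2 ^ n * t\<rfloor> - 2 ^ n * t\<bar> / 2 ^ n" by simp
      also have "\<dots> \<le> 1 / 2 ^ n" by (intro divide_right_mono) (linarith | simp)+
      also have "\<dots> \<le> (1/2) ^ N" using that power_decreasing[of N n "1/2::real"] by (simp add: power_divide)
      finally show ?thesis using N by linarith
    qed
    then show "\<exists>N. \<forall>n\<ge>N. norm (of_int \<lfloor>2 ^ n * t\<rfloor> / 2 ^ n - t) < e" by blast
  qed
  then have "(\<lambda>n. W (of_int \<lfloor>2 ^ n * t\<rfloor> / 2 ^ n) \<omega>) \<longlonglongrightarrow> W t \<omega>"
    by (intro continuous_on_tendsto_compose[OF c[OF x(2)]]) auto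
  then show "(\<lambda>n. case x of (t, \<omega>) \<Rightarrow> W (of_int \<lfloor>2 ^ n * t\<rfloor> / 2 ^ n) \<omega>) \<longlonglongrightarrow> (case x of (t, \<omega>) \<Rightarrow> W t \<omega>)"
    by (simp add: x)
qed

text \<open>The antiderivative is -2 r^3 / sqrt u, and reflection doubles the one-sided value.
  Convergence at infinity is where the exponent 3 from \<open>prob_increment_small\<close> pays
  off.\<close>

lemma nn_integral_inverse_sqrt_cube_tail:
  fixes r a s :: real
  assumes r: "0 < r" and a: "0 < a"
  shows "(\<integral>\<^sup>+t. (if a \<le> \<bar>t - s\<bar> then ennreal ((r / sqrt \<bar>t - s\<bar>) ^ 3) else 0) \<partial>lborel) \<le> ennreal (4 * r ^ 3 / sqrt a)"
proof -
  let ?f = "\<lambda>u::real. (r / sqrt u) ^ 3"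
  have half: "(\<integral>\<^sup>+u. ennreal (?f u) * indicator {a..} u \<partial>lborel) = ennreal (2 * r ^ 3 / sqrt a)"
  proof -
    have "(\<integral>\<^sup>+u. ennreal (?f u) * indicator {a..} u \<partial>lborel) = ennreal (0 - (- 2 * r ^ 3 / sqrt a))"
    proof (rule nn_integral_FTC_atLeast)
      fix u assume "a \<le> u"
      then have u: "0 < u" using a by simp
      have nz: "sqrt u \<noteq> 0" using u by simp
      have "((\<lambda>u. - 2 * r ^ 3 * inverse (sqrt u)) has_real_derivative (- 2 * r ^ 3 * (- (inverse (sqrt u) * (inverse (sqrt u) / 2) * inverse (sqrt u))))) (at u)"
        using DERIV_cmult[OF DERIV_inverse'[OF DERIV_real_sqrt[OF u] nz], of "- 2 * r ^ 3"] .
      moreover have "- 2 * R * (- (i * (i / 2) * i)) = R * i * i * i" for R i :: real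
        by simp
      moreover have "?f u = r ^ 3 * inverse (sqrt u) * inverse (sqrt u) * inverse (sqrt u)"
        unfolding divide_inverse power3_eq_cube by (simp only: mult_ac)
      ultimately show "((\<lambda>u. - 2 * r ^ 3 / sqrt u) has_real_derivative ?f u) (at u)"
        unfolding divide_inverse by metis
    next
      have "((\<lambda>u. - 2 * r ^ 3 * inverse (sqrt u)) \<longlongrightarrow> - 2 * r ^ 3 * 0) at_top"
        by (intro tendsto_mult_left tendsto_inverse_0_at_top sqrt_at_top)
      then show "((\<lambda>u. - 2 * r ^ 3 / sqrt u) \<longlongrightarrow> 0) at_top" by (simp add: divide_inverse)
    qed (use r a in auto)
    then show ?thesis by simp
  qed
  let ?g = "\<lambda>u::real. if a \<le> \<bar>u\<bar> then ennreal (?f \<bar>u\<bar>) else 0"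
  have "(\<integral>\<^sup>+t. ?g (t - s) \<partial>lborel) = (\<integral>\<^sup>+u. ?g u \<partial>lborel)"
    using nn_integral_real_affine[of "\<lambda>t. ?g (t - s)" 1 s] by (simp cong: if_cong)
  also have "\<dots> = (\<integral>\<^sup>+u. ennreal (?f u) * indicator {a..} u + ennreal (?f (- u)) * indicator {a..} (- u) \<partial>lborel)"
    using a by (intro nn_integral_cong) (auto simp: indicator_def abs_if)
  also have "\<dots> = (\<integral>\<^sup>+u. ennreal (?f u) * indicator {a..} u \<partial>lborel) + (\<integral>\<^sup>+u. ennreal (?f (- u)) * indicator {a..} (- u) \<partial>lborel)"
    by (rule nn_integral_add) measurable
  also have "(\<integral>\<^sup>+u. ennreal (?f (- u)) * indicator {a..} (- u) \<partial>lborel) = (\<integral>\<^sup>+u. ennreal (?f u) * indicator {a..} u \<partial>lborel)"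
    using nn_integral_real_affine[of "\<lambda>u. ennreal (?f u) * indicator {a..} u" "-1" 0] by simp
  also note half
  also have "ennreal (2 * r ^ 3 / sqrt a) + ennreal (2 * r ^ 3 / sqrt a) = ennreal (4 * r ^ 3 / sqrt a)"
    using r a by (simp flip: ennreal_plus)
  finally show ?thesis by simp
qed

section \<open>Near and far pairs of times\<close>

context brownian_motion begin

text \<open>Joint measurability is derived from continuity of every path, whereas \<open>B\<close>
  has it almost surely. The set of discontinuous paths may fail to be measurable, so paths are set
  to 0 on a null set covering it. Clamping extends them to all real times.\<close>

lemma continuous_modification:
  obtains W where "\<And>t. W t \<in> borel_measurable M" "\<And>\<omega>. continuous_on UNIV (\<lambda>t. W t \<omega>)"
    "AE \<omega> in M. \<forall>t. W t \<omega> = B (max 0 (min 1 t)) \<omega>"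
proof -
  obtain N where N: "{\<omega>\<in>space M. \<not> continuous_on {0..1} (\<lambda>t. B t \<omega>)} \<subseteq> N" "N \<in> null_sets M"
    using continuous_paths by (auto elim!: AE_E simp: null_sets_def)
  let ?G = "space M - N"
  define W where "W t \<omega> = (if \<omega> \<in> ?G then B (max 0 (min 1 t)) \<omega> else 0)" for t \<omega>
  have Gm: "?G \<in> sets M" using N by auto
  show thesis
  proof
    show "W t \<in> borel_measurable M" for t
      unfolding W_def[abs_def] using Gm measurable_B[of "max 0 (min 1 t)"]
      by (intro measurable_If_set) auto
    show "continuous_on UNIV (\<lambda>t. W t \<omega>)" for \<omega>
    proof (cases "\<omega> \<in> ?G")
      case True
      then have "continuous_on {0..1} (\<lambda>t. B t \<omega>)" using N by auto
      then have "continuous_on UNIV (\<lambda>t. B (max 0 (min 1 t)) \<omega>)"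
        by (rule continuous_on_compose2) (auto intro!: continuous_intros)
      then show ?thesis using True by (simp add: W_def)
    next
      case False
      then show ?thesis unfolding W_def by (simp only: if_False continuous_on_const)
    qed
    have "AE \<omega> in M. \<omega> \<notin> N" using N(2) by (rule AE_not_in)
    then show "AE \<omega> in M. \<forall>t. W t \<omega> = B (max 0 (min 1 t)) \<omega>"
      using AE_space by eventually_elim (auto simp: W_def)
  qed
qed

text \<open>The pair mass of the occupation measure is the \<open>D\<close>-measure of pairs of
  times whose positions are within r. Near pairs \<open>P\<close> are controlled through mean and
  variance of \<open>X\<close>, far pairs \<open>F\<close> through the mean of
  \<open>Y\<close>.\<close>

lemma AE_occupation_measure:
  assumes d: "CARD('n) \<ge> 3"
  shows "AE \<omega> in M. \<exists>\<nu> C. supported_prob ((\<lambda>t. B t \<omega>) ` {0..1}) \<nu> \<and> (\<forall>n. pair_mass \<nu> ((1/4) ^ n) \<le> ennreal (C * (1/16) ^ n))"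
proof -
  obtain W where Wm[measurable]: "\<And>t. W t \<in> borel_measurable M" and Wc: "\<And>\<omega>. continuous_on UNIV (\<lambda>t. W t \<omega>)"
    and WB: "AE \<omega> in M. \<forall>t. W t \<omega> = B (max 0 (min 1 t)) \<omega>"
    using continuous_modification by blast
  have Wj[measurable]: "(\<lambda>(t, \<omega>). W t \<omega>) \<in> borel_measurable (borel \<Otimes>\<^sub>M M)"
    using Wm Wc by (rule jointly_measurable_continuous)
  define U where "U = unit_lebesgue"
  have sU[measurable_cong]: "sets U = sets borel" by (simp add: U_def)
  have spU: "space U = UNIV" by (simp add: U_def)
  interpret U: prob_space U unfolding U_def by (rule prob_space_unit_lebesgue)
  interpret UU: pair_prob_space U U ..
  define D where "D = U \<Otimes>\<^sub>M U"
  have sD[measurable_cong]: "sets D = sets (borel \<Otimes>\<^sub>M borel)" unfolding D_def by (intro sets_pair_measure_cong sU)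
  interpret D: prob_space D unfolding D_def by (rule UU.prob_space_axioms)
  have spD: "space D = UNIV" by (simp add: D_def space_pair_measure spU)
  define q where "q r s t = prob {\<omega>\<in>space M. norm (W t \<omega> - W s \<omega>) \<le> r}" for r s t
  have transfer: "prob {\<omega>\<in>space M. W t \<omega> - W s \<omega> \<in> V} = prob {\<omega>\<in>space M. B (max 0 (min 1 t)) \<omega> - B (max 0 (min 1 s)) \<omega> \<in> V}"
    if [measurable]: "V \<in> sets borel" for s t V
  proof (rule measure_eq_AE)
    have [measurable]: "(\<lambda>\<omega>. B (max 0 (min 1 t)) \<omega> - B (max 0 (min 1 s)) \<omega>) \<in> borel_measurable M"
      by (rule measurable_increment) auto
    show "{\<omega>\<in>space M. B (max 0 (min 1 t)) \<omega> - B (max 0 (min 1 s)) \<omega> \<in> V} \<in> sets M" by measurable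
    show "{\<omega>\<in>space M. W t \<omega> - W s \<omega> \<in> V} \<in> sets M" by measurable
    show "AE \<omega> in M. (\<omega> \<in> {\<omega>\<in>space M. W t \<omega> - W s \<omega> \<in> V}) = (\<omega> \<in> {\<omega>\<in>space M. B (max 0 (min 1 t)) \<omega> - B (max 0 (min 1 s)) \<omega> \<in> V})"
      using WB by eventually_elim auto
  qed
  have transfer2: "prob {\<omega>\<in>space M. W t \<omega> - W s \<omega> \<in> V \<and> W t' \<omega> - W s' \<omega> \<in> V} =
      prob {\<omega>\<in>space M. B (max 0 (min 1 t)) \<omega> - B (max 0 (min 1 s)) \<omega> \<in> V \<and> B (max 0 (min 1 t')) \<omega> - B (max 0 (min 1 s')) \<omega> \<in> V}"
    if [measurable]: "V \<in> sets borel" for s t s' t' V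
  proof (rule measure_eq_AE)
    have [measurable]: "(\<lambda>\<omega>. B (max 0 (min 1 t)) \<omega> - B (max 0 (min 1 s)) \<omega>) \<in> borel_measurable M" for s t
      by (rule measurable_increment) auto
    show "{\<omega>\<in>space M. B (max 0 (min 1 t)) \<omega> - B (max 0 (min 1 s)) \<omega> \<in> V \<and> B (max 0 (min 1 t')) \<omega> - B (max 0 (min 1 s')) \<omega> \<in> V} \<in> sets M" by measurable
    show "{\<omega>\<in>space M. W t \<omega> - W s \<omega> \<in> V \<and> W t' \<omega> - W s' \<omega> \<in> V} \<in> sets M" by measurable
    show "AE \<omega> in M. (\<omega> \<in> {\<omega>\<in>space M. W t \<omega> - W s \<omega> \<in> V \<and> W t' \<omega> - W s' \<omega> \<in> V}) = (\<omega> \<in> {\<omega>\<in>space M. B (max 0 (min 1 t)) \<omega> - B (max 0 (min 1 s)) \<omega> \<in> V \<and> B (max 0 (min 1 t')) \<omega> - B (max 0 (min 1 s')) \<omega> \<in> V})"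
      using WB by eventually_elim auto
  qed
  have ballm: "{x :: real ^ 'n. norm x \<le> r} \<in> sets borel" for r by measurable
  have qsym: "q r s t = q r t s" for r s t
    unfolding q_def by (simp add: norm_minus_commute)
  have q_le: "q r s t \<le> (r / sqrt \<bar>t - s\<bar>) ^ 3" if "0 \<le> r" "s \<in> {0..1}" "t \<in> {0..1}" "s \<noteq> t" for r s t
  proof -
    have *: "q r s t \<le> (r / sqrt (t - s)) ^ 3" if "s \<in> {0..1}" "t \<in> {0..1}" "s < t" for s t
      using transfer[OF ballm, of t s r] prob_increment_small[of s t r] that \<open>0 \<le> r\<close> d
      by (simp add: q_def min_def max_def)
    show ?thesis using *[of s t] *[of t s] that qsym[of r s t] by (cases s t rule: linorder_cases) auto
  qed
  \<comment> \<open>Naming the joint probability makes its symmetries \<open>E1\<close> to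
    \<open>E3\<close> usable as equations, which reduce any order of endpoints to the increasing
    one.\<close>
  define E where "E r s t s' t' = prob {\<omega>\<in>space M. norm (W t \<omega> - W s \<omega>) \<le> r \<and> norm (W t' \<omega> - W s' \<omega>) \<le> r}" for r s t s' t'
  have swap: "norm (W t \<omega> - W s \<omega>) = norm (W s \<omega> - W t \<omega>)" for s t \<omega>
    by (rule norm_minus_commute)
  have E1: "E r s t s' t' = E r t s s' t'" for r s t s' t'
    unfolding E_def swap[of t _ s] ..
  have E2: "E r s t s' t' = E r s t t' s'" for r s t s' t'
    unfolding E_def swap[of t' _ s'] ..
  have E3: "E r s t s' t' = E r s' t' s t" for r s t s' t'
    unfolding E_def by (simp only: conj_commute)
  have ind_ord: "E r s t s' t' = q r s t * q r s' t'" if "s \<le> t" "t \<le> s'" "s' \<le> t'" for r s t s' t'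
  proof -
    \<comment> \<open>Clamping is monotone, so ordered real times stay ordered inside [0,1].\<close>
    let ?c = "\<lambda>t :: real. max 0 (min 1 t)"
    have "E r s t s' t' = prob {\<omega>\<in>space M. B (?c t) \<omega> - B (?c s) \<omega> \<in> {x. norm x \<le> r} \<and> B (?c t') \<omega> - B (?c s') \<omega> \<in> {x. norm x \<le> r}}"
      using transfer2[OF ballm, of t s r t' s'] by (simp only: E_def mem_Collect_eq)
    also have "\<dots> = prob {\<omega>\<in>space M. B (?c t) \<omega> - B (?c s) \<omega> \<in> {x. norm x \<le> r}} * prob {\<omega>\<in>space M. B (?c t') \<omega> - B (?c s') \<omega> \<in> {x. norm x \<le> r}}"
      by (intro prob_increments_indep ballm max.mono min.mono order_refl that) auto
    also have "\<dots> = q r s t * q r s' t'"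
      unfolding transfer[OF ballm, symmetric] by (simp add: q_def)
    finally show ?thesis .
  qed
  have ind_half: "E r s t s' t' = q r s t * q r s' t'" if le: "max s t \<le> min s' t'" for r s t s' t'
  proof -
    have "E r (min s t) (max s t) (min s' t') (max s' t') = q r (min s t) (max s t) * q r (min s' t') (max s' t')"
      using le by (intro ind_ord) auto
    moreover have "q r (min a b) (max a b) = q r a b" for a b
      using qsym[of r a b] by (cases "a \<le> b") (auto simp: min_def max_def)
    moreover have "E r (min s t) (max s t) (min s' t') (max s' t') = E r s t s' t'"
      using E1[of r s t] E2[of r s t s' t'] E2[of r t s s' t']
      by (cases "s \<le> t"; cases "s' \<le> t'") (simp_all add: min_def max_def)
    ultimately show ?thesis by simp
  qed
  have ind: "prob {\<omega>\<in>space M. norm (W t \<omega> - W s \<omega>) \<le> r \<and> norm (W t' \<omega> - W s' \<omega>) \<le> r} = q r s t * q r s' t'"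
    if "max s t \<le> min s' t' \<or> max s' t' \<le> min s t" for r s t s' t'
    using that
  proof
    assume "max s t \<le> min s' t'"
    from ind_half[OF this, of r] show ?thesis by (simp only: E_def)
  next
    assume "max s' t' \<le> min s t"
    from ind_half[OF this, of r] have "E r s t s' t' = q r s t * q r s' t'" by (subst E3) (simp only: mult.commute)
    then show ?thesis by (simp only: E_def)
  qed
  \<comment> \<open>Pairs of times are split at distance \<open>h = r\<^sup>3\<^sup>/\<^sup>2\<close>: the relative variance of the near part is of
    order \<open>h\<^sup>2/r\<^sup>2\<close> and the relative expectation of the far part of order \<open>r/\<surd>h\<close>; both are summable along
    \<open>r = 4\<^sup>-\<^sup>n\<close>.\<close>
  define r h :: "nat \<Rightarrow> real" where "r n = (1/4) ^ n" and "h n = (1/8) ^ n" for n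
  have r0: "0 < r n" and h0: "0 < h n" for n by (auto simp: r_def h_def)
  define P where "P n p \<omega> \<longleftrightarrow> \<bar>fst p - snd p\<bar> \<le> h n \<and> norm (W (snd p) \<omega> - W (fst p) \<omega>) \<le> r n" for n p \<omega>
  define F where "F n p \<omega> \<longleftrightarrow> h n < \<bar>fst p - snd p\<bar> \<and> norm (W (snd p) \<omega> - W (fst p) \<omega>) \<le> r n" for n p \<omega>
  \<comment> \<open>Two near pairs that are not dependent in this sense span intervals without common interior.\<close>
  define dep where "dep n p p' \<longleftrightarrow> \<bar>fst p' - fst p\<bar> \<le> 2 * h n \<and> \<bar>snd p' - fst p'\<bar> \<le> h n" for n and p p' :: "real \<times> real"
  have incr[measurable]: "(\<lambda>(p, \<omega>). W (snd p) \<omega> - W (fst p) \<omega>) \<in> borel_measurable (D \<Otimes>\<^sub>M M)"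
    by measurable
  have Pm[measurable]: "Measurable.pred (D \<Otimes>\<^sub>M M) (\<lambda>(p, \<omega>). P n p \<omega>)" for n
    unfolding P_def by measurable
  have Fm[measurable]: "Measurable.pred (D \<Otimes>\<^sub>M M) (\<lambda>(p, \<omega>). F n p \<omega>)" for n
    unfolding F_def by measurable
  have depm[measurable]: "Measurable.pred (D \<Otimes>\<^sub>M D) (\<lambda>(p, p'). dep n p p')" for n
    unfolding dep_def by measurable
  have intD: "(\<integral>\<^sup>+p. f p \<partial>D) = (\<integral>\<^sup>+s. \<integral>\<^sup>+t. f (s, t) \<partial>U \<partial>U)" if "f \<in> borel_measurable D" for f
    using that unfolding D_def by (rule U.nn_integral_fst[symmetric])
  have Uint: "emeasure U {a..b} \<le> ennreal (b - a)" if "a \<le> b" for a b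
    using nn_integral_unit_lebesgue_le[of "indicator {a..b}"] that by (simp add: U_def)
  \<comment> \<open>The dependent pairs fill a strip: the first time ranges over length 4h, the
    second over length 2h around the first.\<close>
  have dep_mass: "emeasure D {p'\<in>space D. dep n p p'} \<le> ennreal (8 * (h n)\<^sup>2)" if [measurable]: "p \<in> space D" for n p
  proof -
    have "emeasure D {p'\<in>space D. dep n p p'} = (\<integral>\<^sup>+p'. indicator {p'\<in>space D. dep n p p'} p' \<partial>D)"
      by (rule nn_integral_indicator[symmetric]) measurable
    also have "\<dots> = (\<integral>\<^sup>+s. \<integral>\<^sup>+t. indicator {p'\<in>space D. dep n p p'} (s, t) \<partial>U \<partial>U)"
      by (rule intD) measurable
    also have "\<dots> = (\<integral>\<^sup>+s. \<integral>\<^sup>+t. indicator {fst p - 2 * h n..fst p + 2 * h n} s * indicator {s - h n..s + h n} t \<partial>U \<partial>U)"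
      by (intro nn_integral_cong) (auto simp: dep_def spD indicator_def)
    also have "\<dots> = (\<integral>\<^sup>+s. indicator {fst p - 2 * h n..fst p + 2 * h n} s * emeasure U {s - h n..s + h n} \<partial>U)"
      by (intro nn_integral_cong) (simp add: nn_integral_cmult sU)
    also have "\<dots> \<le> (\<integral>\<^sup>+s. indicator {fst p - 2 * h n..fst p + 2 * h n} s * ennreal (2 * h n) \<partial>U)"
    proof (intro nn_integral_mono mult_left_mono)
      show "emeasure U {s - h n..s + h n} \<le> ennreal (2 * h n)" for s
        using Uint[of "s - h n" "s + h n"] h0[of n] by simp
    qed auto
    also have "\<dots> = emeasure U {fst p - 2 * h n..fst p + 2 * h n} * ennreal (2 * h n)"
      by (simp add: nn_integral_multc sU)
    also have "\<dots> \<le> ennreal (4 * h n) * ennreal (2 * h n)"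
      using Uint[of "fst p - 2 * h n" "fst p + 2 * h n"] h0[of n] by (intro mult_right_mono) auto
    also have "\<dots> = ennreal (8 * (h n)\<^sup>2)"
      using h0[of n] by (simp add: power2_eq_square flip: ennreal_mult)
    finally show ?thesis .
  qed
  have probP: "prob {\<omega>\<in>space M. P n p \<omega>} = (if \<bar>fst p - snd p\<bar> \<le> h n then q (r n) (fst p) (snd p) else 0)" for n p
    by (simp add: P_def q_def)
  have ind_dep: "prob {\<omega>\<in>space M. P n p \<omega> \<and> P n p' \<omega>} \<le> prob {\<omega>\<in>space M. P n p \<omega>} * prob {\<omega>\<in>space M. P n p' \<omega>}"
    if "p \<in> space D" "p' \<in> space D" and nd: "\<not> dep n p p'" for n p p'
  proof (cases "\<bar>fst p - snd p\<bar> \<le> h n \<and> \<bar>fst p' - snd p'\<bar> \<le> h n")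
    case True
    \<comment> \<open>The first endpoints are more than 2h apart and both intervals have length at
      most h, so one precedes the other.\<close>
    then have "max (fst p) (snd p) \<le> min (fst p') (snd p') \<or> max (fst p') (snd p') \<le> min (fst p) (snd p)"
      using nd by (auto simp: dep_def)
    from ind[OF this, of "r n"] True show ?thesis
      by (simp add: probP) (simp add: P_def)
  next
    case False
    then have e: "{\<omega>\<in>space M. P n p \<omega> \<and> P n p' \<omega>} = {}" by (auto simp: P_def)
    show ?thesis unfolding e by simp
  qed
  define X where "X n \<omega> = measure D {p\<in>space D. P n p \<omega>}" for n \<omega>
  have h2: "0 \<le> 8 * (h n)\<^sup>2" for n by simp
  note var_bounds = variance_measure_section[OF D.prob_space_axioms Pm depm ind_dep h2 dep_mass, folded X_def]
  have var: "X n \<in> borel_measurable M"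
    "ennreal (expectation (X n)) = (\<integral>\<^sup>+p. emeasure M {\<omega>\<in>space M. P n p \<omega>} \<partial>D)"
    "(\<integral>\<^sup>+\<omega>. ennreal ((X n \<omega> - expectation (X n))\<^sup>2) \<partial>M) \<le> ennreal (8 * (h n)\<^sup>2 * expectation (X n))" for n
    by (rule var_bounds; assumption)+
  have Xm[measurable]: "X n \<in> borel_measurable M" for n by (rule var(1))
  have q1: "q r s t \<le> 1" for r s t by (simp add: q_def)
  have qm[measurable]: "(\<lambda>p. emeasure M {\<omega>\<in>space M. P n p \<omega>}) \<in> borel_measurable D" "(\<lambda>p. emeasure M {\<omega>\<in>space M. F n p \<omega>}) \<in> borel_measurable D" for n
    by measurable
  have tail: "(\<integral>\<^sup>+t. (if a \<le> \<bar>t - s\<bar> then ennreal ((r n / sqrt \<bar>t - s\<bar>) ^ 3) else 0) \<partial>U) \<le> ennreal (4 * r n ^ 3 / sqrt a)" if "0 < a" for n s a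
  proof -
    have "(\<integral>\<^sup>+t. (if a \<le> \<bar>t - s\<bar> then ennreal ((r n / sqrt \<bar>t - s\<bar>) ^ 3) else 0) \<partial>U) \<le> (\<integral>\<^sup>+t. (if a \<le> \<bar>t - s\<bar> then ennreal ((r n / sqrt \<bar>t - s\<bar>) ^ 3) else 0) \<partial>lborel)"
      unfolding U_def by (rule nn_integral_unit_lebesgue_le) measurable
    also have "\<dots> \<le> ennreal (4 * r n ^ 3 / sqrt a)"
      by (rule nn_integral_inverse_sqrt_cube_tail[OF r0 that])
    finally show ?thesis .
  qed
  have AEU: "AE t in U. t \<in> {0..1}" unfolding U_def by (rule AE_unit_lebesgue)
  \<comment> \<open>Here the split is at the diffusive time scale r^2, not at h: closer times
    contribute at most 2r^2 with the trivial bound 1, and the tail contributes 4r^3/sqrt(r^2) =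
    4r^2.\<close>
  have EX: "expectation (X n) \<le> 6 * (r n)\<^sup>2" for n
  proof -
    have inner: "(\<integral>\<^sup>+t. emeasure M {\<omega>\<in>space M. P n (s, t) \<omega>} \<partial>U) \<le> ennreal (6 * (r n)\<^sup>2)" if s: "s \<in> {0..1}" for s
    proof -
      have "(\<integral>\<^sup>+t. emeasure M {\<omega>\<in>space M. P n (s, t) \<omega>} \<partial>U) \<le>
        (\<integral>\<^sup>+t. indicator {s - (r n)\<^sup>2..s + (r n)\<^sup>2} t + (if (r n)\<^sup>2 \<le> \<bar>t - s\<bar> then ennreal ((r n / sqrt \<bar>t - s\<bar>) ^ 3) else 0) \<partial>U)"
      proof (rule nn_integral_mono_AE)
        show "AE t in U. emeasure M {\<omega>\<in>space M. P n (s, t) \<omega>} \<le> indicator {s - (r n)\<^sup>2..s + (r n)\<^sup>2} t + (if (r n)\<^sup>2 \<le> \<bar>t - s\<bar> then ennreal ((r n / sqrt \<bar>t - s\<bar>) ^ 3) else 0)"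
          using AEU
        proof eventually_elim
          case (elim t)
          have e: "emeasure M {\<omega>\<in>space M. P n (s, t) \<omega>} \<le> ennreal (q (r n) s t)"
            using probP[of n "(s, t)"] by (simp add: emeasure_eq_measure ennreal_leI q_def)
          show ?case
          proof (cases "(r n)\<^sup>2 \<le> \<bar>t - s\<bar>")
            case True
            then have "s \<noteq> t" using r0[of n] by auto
            then have "q (r n) s t \<le> (r n / sqrt \<bar>t - s\<bar>) ^ 3"
              using r0[of n] s elim by (intro q_le) auto
            then have "ennreal (q (r n) s t) \<le> ennreal ((r n / sqrt \<bar>t - s\<bar>) ^ 3)" by (rule ennreal_leI)
            with e True show ?thesis by (auto intro: order_trans add_increasing)
          next
            case False
            have "ennreal (q (r n) s t) \<le> 1" using q1 by simp
            then show ?thesis using e False by (auto simp: indicator_def intro: order_trans)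
          qed
        qed
      qed
      also have "\<dots> = (\<integral>\<^sup>+t. indicator {s - (r n)\<^sup>2..s + (r n)\<^sup>2} t \<partial>U) + (\<integral>\<^sup>+t. (if (r n)\<^sup>2 \<le> \<bar>t - s\<bar> then ennreal ((r n / sqrt \<bar>t - s\<bar>) ^ 3) else 0) \<partial>U)"
        by (rule nn_integral_add) measurable
      also have "\<dots> \<le> ennreal (2 * (r n)\<^sup>2) + ennreal (4 * r n ^ 3 / sqrt ((r n)\<^sup>2))"
        using Uint[of "s - (r n)\<^sup>2" "s + (r n)\<^sup>2"] r0[of n] by (intro add_mono tail) (auto simp: sU)
      also have "\<dots> = ennreal (6 * (r n)\<^sup>2)"
        using r0[of n] by (simp add: power3_eq_cube power2_eq_square flip: ennreal_plus)
      finally show ?thesis .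
    qed
    have "ennreal (expectation (X n)) = (\<integral>\<^sup>+s. \<integral>\<^sup>+t. emeasure M {\<omega>\<in>space M. P n (s, t) \<omega>} \<partial>U \<partial>U)"
      unfolding var(2) by (rule intD) measurable
    also have "\<dots> \<le> (\<integral>\<^sup>+s. ennreal (6 * (r n)\<^sup>2) \<partial>U)"
    proof (rule nn_integral_mono_AE)
      show "AE s in U. (\<integral>\<^sup>+t. emeasure M {\<omega>\<in>space M. P n (s, t) \<omega>} \<partial>U) \<le> ennreal (6 * (r n)\<^sup>2)"
        using AEU by eventually_elim (rule inner)
    qed
    also have "\<dots> = ennreal (6 * (r n)\<^sup>2)" by (simp add: U.emeasure_space_1)
    finally show ?thesis by (subst (asm) ennreal_le_iff) auto
  qed
  define Y where "Y n \<omega> = emeasure D {p\<in>space D. F n p \<omega>}" for n \<omega>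
  have Ym[measurable]: "Y n \<in> borel_measurable M" for n
  proof -
    interpret DM: pair_prob_space D M ..
    show ?thesis unfolding Y_def[abs_def] by measurable
  qed
  have EY: "(\<integral>\<^sup>+\<omega>. Y n \<omega> \<partial>M) \<le> ennreal (4 * r n ^ 3 / sqrt (h n))" for n
  proof -
    interpret DM: pair_prob_space D M ..
    have "(\<integral>\<^sup>+\<omega>. Y n \<omega> \<partial>M) = (\<integral>\<^sup>+\<omega>. \<integral>\<^sup>+p. (if F n p \<omega> then 1 else 0) \<partial>D \<partial>M)"
    proof (intro nn_integral_cong)
      fix \<omega> assume [measurable]: "\<omega> \<in> space M"
      have "Y n \<omega> = (\<integral>\<^sup>+p. indicator {p\<in>space D. F n p \<omega>} p \<partial>D)"
        unfolding Y_def by (rule nn_integral_indicator[symmetric]) measurable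
      also have "\<dots> = (\<integral>\<^sup>+p. (if F n p \<omega> then 1 else 0) \<partial>D)"
        by (intro nn_integral_cong) (auto simp: indicator_def)
      finally show "Y n \<omega> = (\<integral>\<^sup>+p. (if F n p \<omega> then 1 else 0) \<partial>D)" .
    qed
    also have "\<dots> = (\<integral>\<^sup>+p. \<integral>\<^sup>+\<omega>. (if F n p \<omega> then 1 else 0) \<partial>M \<partial>D)"
      by (rule DM.Fubini') measurable
    also have "\<dots> = (\<integral>\<^sup>+p. emeasure M {\<omega>\<in>space M. F n p \<omega>} \<partial>D)"
    proof (intro nn_integral_cong)
      fix p assume [measurable]: "p \<in> space D"
      have "emeasure M {\<omega>\<in>space M. F n p \<omega>} = (\<integral>\<^sup>+\<omega>. indicator {\<omega>\<in>space M. F n p \<omega>} \<omega> \<partial>M)"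
        by (rule nn_integral_indicator[symmetric]) measurable
      also have "\<dots> = (\<integral>\<^sup>+\<omega>. (if F n p \<omega> then 1 else 0) \<partial>M)"
        by (intro nn_integral_cong) (auto simp: indicator_def)
      finally show "(\<integral>\<^sup>+\<omega>. (if F n p \<omega> then 1 else 0) \<partial>M) = emeasure M {\<omega>\<in>space M. F n p \<omega>}" by simp
    qed
    also have "\<dots> = (\<integral>\<^sup>+s. \<integral>\<^sup>+t. emeasure M {\<omega>\<in>space M. F n (s, t) \<omega>} \<partial>U \<partial>U)"
      by (rule intD) measurable
    also have "\<dots> \<le> (\<integral>\<^sup>+s. ennreal (4 * r n ^ 3 / sqrt (h n)) \<partial>U)"
      using AEU
    proof (intro nn_integral_mono_AE, eventually_elim)
      case (elim s)
      have "(\<integral>\<^sup>+t. emeasure M {\<omega>\<in>space M. F n (s, t) \<omega>} \<partial>U) \<le> (\<integral>\<^sup>+t. (if h n \<le> \<bar>t - s\<bar> then ennreal ((r n / sqrt \<bar>t - s\<bar>) ^ 3) else 0) \<partial>U)"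
        using AEU
      proof (intro nn_integral_mono_AE, eventually_elim)
        case (elim t)
        show ?case
        proof (cases "h n < \<bar>t - s\<bar>")
          case True
          then have "s \<noteq> t" using h0[of n] by auto
          then have "q (r n) s t \<le> (r n / sqrt \<bar>t - s\<bar>) ^ 3"
            using r0[of n] \<open>s \<in> {0..1}\<close> elim by (intro q_le) auto
          moreover have "{\<omega>\<in>space M. F n (s, t) \<omega>} = {\<omega>\<in>space M. norm (W t \<omega> - W s \<omega>) \<le> r n}"
            using True by (auto simp: F_def abs_minus_commute)
          ultimately show ?thesis using True by (simp add: emeasure_eq_measure ennreal_leI q_def)
        next
          case False
          then have "{\<omega>\<in>space M. F n (s, t) \<omega>} = {}" by (auto simp: F_def abs_minus_commute)
          then show ?thesis by (simp only: emeasure_empty zero_le)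
        qed
      qed
      also have "\<dots> \<le> ennreal (4 * r n ^ 3 / sqrt (h n))" by (rule tail[OF h0])
      finally show ?case .
    qed
    also have "\<dots> = ennreal (4 * r n ^ 3 / sqrt (h n))" by (simp add: U.emeasure_space_1)
    finally show ?thesis .
  qed
  have r2: "16 ^ n * (r n)\<^sup>2 = 1" for n
  proof -
    have "(16::real) ^ n = 4 ^ n * 4 ^ n" by (simp flip: power_mult_distrib)
    then show ?thesis by (simp add: r_def power2_eq_square power_divide)
  qed
  \<comment> \<open>The weight 256^n is r^(-4), so the summands are squared deviations relative to
    r^2.\<close>
  have "(\<Sum>n. \<integral>\<^sup>+\<omega>. ennreal (256 ^ n * (X n \<omega> - expectation (X n))\<^sup>2) \<partial>M) < \<infinity>"
  proof (rule suminf_ennreal_less_top)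
    show "(\<integral>\<^sup>+\<omega>. ennreal (256 ^ n * (X n \<omega> - expectation (X n))\<^sup>2) \<partial>M) \<le> ennreal (48 * (1/4) ^ n)" for n
    proof -
      have "(\<integral>\<^sup>+\<omega>. ennreal (256 ^ n * (X n \<omega> - expectation (X n))\<^sup>2) \<partial>M) = ennreal (256 ^ n) * (\<integral>\<^sup>+\<omega>. ennreal ((X n \<omega> - expectation (X n))\<^sup>2) \<partial>M)"
        by (subst nn_integral_cmult[symmetric]) (auto simp flip: ennreal_mult)
      also have "\<dots> \<le> ennreal (256 ^ n) * ennreal (8 * (h n)\<^sup>2 * expectation (X n))"
        by (intro mult_left_mono var(3)) auto
      also have "\<dots> \<le> ennreal (256 ^ n) * ennreal (8 * (h n)\<^sup>2 * (6 * (r n)\<^sup>2))"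
        by (intro mult_left_mono ennreal_leI EX) auto
      also have "\<dots> = ennreal (256 ^ n * (8 * (h n)\<^sup>2 * (6 * (r n)\<^sup>2)))"
        by (simp flip: ennreal_mult)
      also have "256 ^ n * (8 * (h n)\<^sup>2 * (6 * (r n)\<^sup>2)) = 48 * (1/4) ^ n"
      proof -
        have "(256::real) ^ n = 16 ^ n * 16 ^ n" "(1/4::real) ^ n = 16 ^ n * ((1/8) ^ n * (1/8) ^ n)" by (simp_all flip: power_mult_distrib)
        then have "256 ^ n * (8 * (h n)\<^sup>2 * (6 * (r n)\<^sup>2)) = 48 * (1/4) ^ n * (16 ^ n * (r n)\<^sup>2)"
          by (simp add: h_def power2_eq_square)
        then show ?thesis by (simp add: r2)
      qed
      finally show ?thesis .
    qed
  qed (auto intro!: summable_mult summable_geometric)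
  then have AEX: "AE \<omega> in M. \<exists>K\<ge>0. \<forall>n. ennreal (256 ^ n * (X n \<omega> - expectation (X n))\<^sup>2) \<le> ennreal K"
    by (intro AE_bounded_if_summable_nn_integral) measurable
  \<comment> \<open>The weight 16^n is r^(-2).\<close>
  have "(\<Sum>n. \<integral>\<^sup>+\<omega>. ennreal (16 ^ n) * Y n \<omega> \<partial>M) < \<infinity>"
  proof (rule suminf_ennreal_less_top)
    show "(\<integral>\<^sup>+\<omega>. ennreal (16 ^ n) * Y n \<omega> \<partial>M) \<le> ennreal (4 * (3/4) ^ n)" for n
    proof -
      have "(\<integral>\<^sup>+\<omega>. ennreal (16 ^ n) * Y n \<omega> \<partial>M) = ennreal (16 ^ n) * (\<integral>\<^sup>+\<omega>. Y n \<omega> \<partial>M)"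
        by (rule nn_integral_cmult) measurable
      also have "\<dots> \<le> ennreal (16 ^ n) * ennreal (4 * r n ^ 3 / sqrt (h n))"
        by (intro mult_left_mono EY) auto
      also have "\<dots> = ennreal (16 ^ n * (4 * r n ^ 3 / sqrt (h n)))"
        using r0[of n] h0[of n] by (intro ennreal_mult[symmetric]) auto
      also have "16 ^ n * (4 * r n ^ 3 / sqrt (h n)) \<le> 4 * (3/4) ^ n"
      proof -
        \<comment> \<open>Since 1/9 \<le> 1/8, the irrational rate sqrt(1/8) is replaced by 1/3; the
          resulting ratio 3/4 is still below 1.\<close>
        have "(1/3) ^ n \<le> sqrt (h n)"
        proof (rule real_le_rsqrt)
          have "((1/3::real) ^ n)\<^sup>2 = (1/9) ^ n" by (simp add: power2_eq_square flip: power_mult_distrib)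
          also have "\<dots> \<le> h n" unfolding h_def by (intro power_mono) auto
          finally show "((1/3) ^ n)\<^sup>2 \<le> h n" .
        qed
        then have "1 / sqrt (h n) \<le> 1 / (1/3) ^ n" using h0[of n] by (intro divide_left_mono) auto
        also have "\<dots> = 3 ^ n" by (simp add: power_divide)
        finally have h3: "1 / sqrt (h n) \<le> 3 ^ n" .
        have "16 ^ n * (4 * r n ^ 3 / sqrt (h n)) = (16 ^ n * (r n)\<^sup>2) * (4 * r n) * (1 / sqrt (h n))"
          by (simp add: power3_eq_cube power2_eq_square)
        also have "\<dots> = 4 * r n * (1 / sqrt (h n))" unfolding r2 by simp
        also have "\<dots> \<le> 4 * r n * 3 ^ n" using h3 r0[of n] by (intro mult_left_mono) auto
        also have "\<dots> = 4 * (3/4) ^ n" by (simp add: r_def power_divide)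
        finally show ?thesis .
      qed
      finally show ?thesis by (simp add: ennreal_leI)
    qed
  qed (auto intro!: summable_mult summable_geometric)
  then have AEY: "AE \<omega> in M. \<exists>K\<ge>0. \<forall>n. ennreal (16 ^ n) * Y n \<omega> \<le> ennreal K"
    by (intro AE_bounded_if_summable_nn_integral) measurable
  show ?thesis
    using AEX AEY WB continuous_paths AE_space
  proof eventually_elim
    case (elim \<omega>)
    note w[measurable] = elim(5)
    obtain K where K: "0 \<le> K" "\<And>n. ennreal (256 ^ n * (X n \<omega> - expectation (X n))\<^sup>2) \<le> ennreal K"
      using elim(1) by blast
    obtain L where L: "0 \<le> L" "\<And>n. ennreal (16 ^ n) * Y n \<omega> \<le> ennreal L"
      using elim(2) by blast
    define \<nu> where "\<nu> = distr U borel (\<lambda>t. W t \<omega>)"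
    have Ww[measurable]: "(\<lambda>t. W t \<omega>) \<in> borel_measurable borel"
      using Wc by (rule borel_measurable_continuous_onI)
    \<comment> \<open>Because of the clamping this holds for every real time, so the image measure
      gives the path full mass.\<close>
    have im: "W t \<omega> \<in> (\<lambda>t. B t \<omega>) ` {0..1}" for t
      using elim(3) by auto
    have "closed ((\<lambda>t. B t \<omega>) ` {0..1})"
      using elim(4) by (intro compact_imp_closed compact_continuous_image) auto
    then have "emeasure \<nu> ((\<lambda>t. B t \<omega>) ` {0..1}) = 1"
      unfolding \<nu>_def using im by (subst emeasure_distr) (auto simp: vimage_def spU U.emeasure_space_1[unfolded spU])
    then have sup: "supported_prob ((\<lambda>t. B t \<omega>) ` {0..1}) \<nu>"
      unfolding supported_prob_def \<nu>_def by (auto intro!: U.prob_space_distr)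
    have "pair_mass \<nu> (r n) \<le> ennreal ((6 + sqrt K + L) * (1/16) ^ n)" for n
    proof -
      have r2': "(r n)\<^sup>2 = (1/16) ^ n" by (simp add: r_def power2_eq_square flip: power_mult_distrib)
      have "256 ^ n * (X n \<omega> - expectation (X n))\<^sup>2 \<le> K"
        using K(2)[of n] K(1) by (subst (asm) ennreal_le_iff) auto
      moreover have "256 ^ n * (X n \<omega> - expectation (X n))\<^sup>2 = (16 ^ n * (X n \<omega> - expectation (X n)))\<^sup>2"
      proof -
        have "(256::real) ^ n = 16 ^ n * 16 ^ n" by (simp flip: power_mult_distrib)
        then show ?thesis by (simp add: power2_eq_square)
      qed
      ultimately have "16 ^ n * (X n \<omega> - expectation (X n)) \<le> sqrt K" using real_le_rsqrt by metis
      then have "X n \<omega> - expectation (X n) \<le> sqrt K * (1/16) ^ n" by (simp add: field_simps power_divide)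
      then have X: "X n \<omega> \<le> (6 + sqrt K) * (1/16) ^ n"
        using EX[of n] unfolding r2' by (simp add: algebra_simps)
      have "Y n \<omega> = ennreal ((1/16) ^ n) * (ennreal (16 ^ n) * Y n \<omega>)"
        by (simp add: power_divide flip: ennreal_mult mult.assoc)
      also have "\<dots> \<le> ennreal ((1/16) ^ n) * ennreal L" by (intro mult_left_mono L) auto
      also have "\<dots> = ennreal (L * (1/16) ^ n)" using L(1) by (simp add: mult.commute flip: ennreal_mult)
      finally have Y: "Y n \<omega> \<le> ennreal (L * (1/16) ^ n)" .
      have "pair_mass \<nu> (r n) = (\<integral>\<^sup>+s. \<integral>\<^sup>+t. indicator {..r n} (norm (W s \<omega> - W t \<omega>)) \<partial>U \<partial>U)"
        unfolding pair_mass_def \<nu>_def by (simp add: nn_integral_distr)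
      also have "\<dots> = (\<integral>\<^sup>+p. indicator {..r n} (norm (W (fst p) \<omega> - W (snd p) \<omega>)) \<partial>D)"
        by (subst intD) (simp_all, measurable)
      also have "\<dots> = (\<integral>\<^sup>+p. indicator ({p\<in>space D. P n p \<omega>} \<union> {p\<in>space D. F n p \<omega>}) p \<partial>D)"
        by (intro nn_integral_cong) (auto simp: indicator_def P_def F_def norm_minus_commute)
      also have "\<dots> = emeasure D ({p\<in>space D. P n p \<omega>} \<union> {p\<in>space D. F n p \<omega>})"
        by (rule nn_integral_indicator) measurable
      also have "\<dots> \<le> emeasure D {p\<in>space D. P n p \<omega>} + emeasure D {p\<in>space D. F n p \<omega>}"
        by (rule emeasure_subadditive) measurable
      also have "\<dots> \<le> ennreal ((6 + sqrt K) * (1/16) ^ n) + ennreal (L * (1/16) ^ n)"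
        using X Y by (intro add_mono) (auto simp: X_def Y_def D.emeasure_eq_measure ennreal_leI)
      also have "\<dots> = ennreal ((6 + sqrt K + L) * (1/16) ^ n)"
        using K(1) L(1) by (simp add: algebra_simps flip: ennreal_plus)
      finally show ?thesis .
    qed
    then show ?case using sup unfolding r_def by blast
  qed
qed

end

theorem theorem1p1:
  fixes M :: "'w measure" and B :: "real \<Rightarrow> 'w \<Rightarrow> real ^ 'n" and i j :: 'n
  assumes "CARD('n) \<ge> 3"
    and "i \<noteq> j"
    and "brownian_motion M B"
  shows "AE \<omega> in M. capacity_equivalent ((\<lambda>t. B t \<omega>) ` {0..1}) (unit_square i j)"
proof -
  interpret brownian_motion M B by fact
  show ?thesis
    using AE_occupation_measure[OF assms(1)] AE_bad_steps_bounded continuous_paths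
  proof eventually_elim
    case (elim \<omega>)
    obtain \<nu> C where nu: "supported_prob ((\<lambda>t. B t \<omega>) ` {0..1}) \<nu>" "\<And>n. pair_mass \<nu> ((1/4) ^ n) \<le> ennreal (C * (1/16) ^ n)"
      using elim(1) by blast
    obtain K where K: "0 \<le> K" "\<And>n l. real (card (bad_steps (\<lambda>t. B t \<omega>) n l)) \<le> K * 4 ^ n * (1/2) ^ l"
      using elim(2) by blast
    have "planar_set ((\<lambda>t. B t \<omega>) ` {0..1})"
      using nu by (rule planar_setI) (rule chaining_cover[OF elim(3) K])
    then show ?case
      using planar_unit_square[OF assms(2)] by (rule planar_sets_capacity_equivalent)
  qed
qed

end
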